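(* Let $\mathbb{K}$ be an algebraically closed field of characteristic zero and $G$ a finite abelian group. Let $S=M_t(\mathbb{K})\otimes_{\mathbb{K}}UT(p_1,\dots,p_m)$ and $S'=M_{t'}(\mathbb{K})\otimes_{\mathbb{K}}UT(p_1',\dots,p_m')$, where $M_t(\mathbb{K})$ and $M_{t'}(\mathbb{K})$ are endowed with fine $G$-gradings, and $UT(p_1,\dots,p_m)$, $UT(p_1',\dots,p_m')$ are endowed with the elementary $G$-gradings defined by tuples $\mathbf{g}=(g_1,\dots,g_n)$ and $\mathbf{g}'=(g_1',\dots,g'_{n'})$ of elements of $G$, respectively ($n=p_1+\cdots+p_m$, $n'=p_1'+\cdots+p_m'$). Then $S$ and $S'$ are isomorphic as $G$-graded algebras if and only if $M_t(\mathbb{K})\cong M_{t'}(\mathbb{K})$ as $G$-graded algebras, $(p_1,\dots,p_m)=(p_1',\dots,p_m')$, and there exist $g\in G$, $h_1,\dots,h_n\in\mathrm{supp}\,M_t(\mathbb{K})$ and $\sigma\in S_{p_1}\times\cdots\times S_{p_m}$ such that $g_i'=g_{\sigma(i)}h_{\sigma(i)}g$ for $i=1,\dots,n$.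
   Context: A $G$-grading on an algebra $A$ is a decomposition $A=\bigoplus_{g\in G}A_g$ into subspaces with $A_gA_h\subseteq A_{gh}$; its support is $\mathrm{supp}\,A=\{g\in G: A_g\ne 0\}$. An isomorphism of $G$-graded algebras is an algebra isomorphism mapping each component of degree $g$ onto the component of degree $g$. A $G$-grading on $A$ is called fine here if $\dim A_g\le 1$ for every $g\in G$. For positive integers $p_1,\dots,p_m$ with $n=p_1+\cdots+p_m$, put $n_0=0$, $n_i=p_1+\cdots+p_i$, $P_i=\{n_{i-1}+1,\dots,n_i\}$. $UT(p_1,\dots,p_m)$ is the algebra of upper block triangular matrices over $\mathbb{K}$, i.e. the subalgebra of $M_n(\mathbb{K})$ spanned by the matrix units $e_{ij}$ with $i\in P_k$, $j\in P_l$, $k\le l$. The elementary grading defined by $(g_1,\dots,g_n)\in G^n$ is the one in which each such $e_{ij}$ is homogeneous of degree $g_ig_j^{-1}$. The tensor product of two $G$-graded algebras $A$, $B$ ($G$ abelian) has the grading $(A\otimes B)_g=\bigoplus_{hk=g}A_h\otimes B_k$. The group $S_{p_1}\times\cdots\times S_{p_m}$ is viewed as the subgroup of $S_n$ of permutations preserving each block $P_i$. *)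

theory Defs
  imports
    "HOL-Library.Function_Algebras"
    "HOL-Library.Groups_Big_Fun"
    "HOL-Combinatorics.Permutations"
    "HOL-Computational_Algebra.Computational_Algebra"
begin

section \<open>Matrices over an arbitrary index type\<close>

text \<open>
  A matrix is a function of two indices. All algebras below are subspaces of the algebra of
  finitely supported matrices over some index type, with addition from
  \<^theory>\<open>HOL-Library.Function_Algebras\<close>. The product is \<open>mat_mult\<close>, not the pointwise
  multiplication of that theory.
\<close>

type_synonym ('i, 'k) imat = "'i \<Rightarrow> 'i \<Rightarrow> 'k"

definition mat_scale :: "'k::times \<Rightarrow> ('i, 'k) imat \<Rightarrow> ('i, 'k) imat" where
  "mat_scale c a = (\<lambda>i j. c * a i j)"

global_interpretation imat: vector_space "mat_scale :: 'k::field \<Rightarrow> ('i, 'k) imat \<Rightarrow> ('i, 'k) imat"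
  by standard (auto simp: mat_scale_def fun_eq_iff algebra_simps)

definition mat_mult :: "('i, 'k::semiring_0) imat \<Rightarrow> ('i, 'k) imat \<Rightarrow> ('i, 'k) imat" where
  "mat_mult a b = (\<lambda>i j. Sum_any (\<lambda>k. a i k * b k j))"

definition matrix_unit :: "'i \<Rightarrow> 'i \<Rightarrow> ('i, 'k::zero_neq_one) imat" where
  "matrix_unit i j = (\<lambda>k l. if k = i \<and> l = j then 1 else 0)"

definition matrix_algebra :: "nat \<Rightarrow> (nat, 'k::zero) imat set" where
  "matrix_algebra t = {a. \<forall>i j. i \<notin> {1..t} \<or> j \<notin> {1..t} \<longrightarrow> a i j = 0}"

lemma mat_mult_eq_sum:
  assumes "finite I" and "\<And>i k. k \<notin> I \<Longrightarrow> a i k = 0"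
  shows "mat_mult a b i j = (\<Sum>k\<in>I. a i k * b k j)"
  unfolding mat_mult_def
proof (rule Sum_any.expand_superset[OF assms(1)])
  show "{k. a i k * b k j \<noteq> 0} \<subseteq> I"
    using assms(2)[of _ i] by force
qed


section \<open>Upper block triangular matrices\<close>

definition block :: "nat list \<Rightarrow> nat \<Rightarrow> nat set" where
  "block p k = {sum_list (take (k - 1) p) + 1 .. sum_list (take k p)}"

definition ut_positions :: "nat list \<Rightarrow> (nat \<times> nat) set" where
  "ut_positions p =
     {(i, j). \<exists>k l. 1 \<le> k \<and> k \<le> l \<and> l \<le> length p \<and> i \<in> block p k \<and> j \<in> block p l}"

definition UT_algebra :: "nat list \<Rightarrow> (nat, 'k::field) imat set" where
  "UT_algebra p = imat.span {matrix_unit i j | i j. (i, j) \<in> ut_positions p}"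


section \<open>Tensor products\<close>

text \<open>
  The tensor product of two matrix algebras is realised inside the matrices indexed by pairs by
  the Kronecker product. That this is the tensor product is justified below: products of basis
  elements form a basis (\<open>tensor_eq_span_basis\<close>, \<open>inj_on_kron_basis\<close>, \<open>independent_kron_basis\<close>),
  and multiplication is factorwise (\<open>mat_mult_kron\<close>).
\<close>

definition kron :: "('i, 'k::times) imat \<Rightarrow> ('j, 'k) imat \<Rightarrow> ('i \<times> 'j, 'k) imat" where
  "kron a b = (\<lambda>x y. a (fst x) (fst y) * b (snd x) (snd y))"

definition tensor :: "('i, 'k::field) imat set \<Rightarrow> ('j, 'k) imat set \<Rightarrow> ('i \<times> 'j, 'k) imat set" where
  "tensor A B = imat.span {kron a b | a b. a \<in> A \<and> b \<in> B}"


section \<open>Gradings by a finite abelian group\<close>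

text \<open>
  The grading group is written additively: the product of group elements is \<open>+\<close>, and
  \<open>-\<close> stands for multiplication by the inverse.
\<close>

definition is_grading ::
  "('i, 'k::field) imat set \<Rightarrow> ('g::{finite, ab_group_add} \<Rightarrow> ('i, 'k) imat set) \<Rightarrow> bool" where
  "is_grading A \<Gamma> \<longleftrightarrow>
     (\<forall>g. imat.subspace (\<Gamma> g) \<and> \<Gamma> g \<subseteq> A) \<and>
     (\<forall>a\<in>A. \<exists>!f. (\<forall>g. f g \<in> \<Gamma> g) \<and> a = (\<Sum>g\<in>UNIV. f g)) \<and>
     (\<forall>g h. \<forall>a\<in>\<Gamma> g. \<forall>b\<in>\<Gamma> h. mat_mult a b \<in> \<Gamma> (g + h))"

definition grading_support :: "('g \<Rightarrow> ('i, 'k::field) imat set) \<Rightarrow> 'g set" where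
  "grading_support \<Gamma> = {g. \<Gamma> g \<noteq> {0}}"

text \<open>\<^term>\<open>imat.dim\<close> is \<open>0\<close> on infinite-dimensional subspaces; here it is only used for subspaces
  of \<^term>\<open>matrix_algebra t\<close>.\<close>

definition is_fine :: "('g \<Rightarrow> ('i, 'k::field) imat set) \<Rightarrow> bool" where
  "is_fine \<Gamma> \<longleftrightarrow> (\<forall>g. imat.dim (\<Gamma> g) \<le> 1)"

definition elementary_grading ::
  "nat list \<Rightarrow> (nat \<Rightarrow> 'g::ab_group_add) \<Rightarrow> 'g \<Rightarrow> (nat, 'k::field) imat set" where
  "elementary_grading p \<gamma> h =
     imat.span {matrix_unit i j | i j. (i, j) \<in> ut_positions p \<and> \<gamma> i - \<gamma> j = h}"

definition tensor_grading ::
  "('g::ab_group_add \<Rightarrow> ('i, 'k::field) imat set) \<Rightarrow> ('g \<Rightarrow> ('j, 'k) imat set)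
     \<Rightarrow> 'g \<Rightarrow> ('i \<times> 'j, 'k) imat set" where
  "tensor_grading \<Gamma> \<Delta> g = imat.span (\<Union>{tensor (\<Gamma> h) (\<Delta> k) | h k. h + k = g})"

definition graded_isomorphic ::
  "('i, 'k::field) imat set \<Rightarrow> ('g \<Rightarrow> ('i, 'k) imat set)
     \<Rightarrow> ('j, 'k) imat set \<Rightarrow> ('g \<Rightarrow> ('j, 'k) imat set) \<Rightarrow> bool" where
  "graded_isomorphic A \<Gamma> B \<Delta> \<longleftrightarrow>
     (\<exists>f. bij_betw f A B \<and>
        (\<forall>a\<in>A. \<forall>b\<in>A. f (a + b) = f a + f b) \<and>
        (\<forall>c. \<forall>a\<in>A. f (mat_scale c a) = mat_scale c (f a)) \<and>
        (\<forall>a\<in>A. \<forall>b\<in>A. f (mat_mult a b) = mat_mult (f a) (f b)) \<and>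
        (\<forall>g. f ` \<Gamma> g = \<Delta> g))"


section \<open>The Kronecker model is the tensor product\<close>

lemma sum_fun_apply2: "(\<Sum>x\<in>X. F x) i j = (\<Sum>x\<in>X. F x i j)"
  for F :: "'x \<Rightarrow> 'i \<Rightarrow> 'j \<Rightarrow> 'k::comm_monoid_add"
  by (induction X rule: infinite_finite_induct) auto

lemma mat_mult_kron:
  fixes a b :: "('i, 'k::field) imat" and c d :: "('j, 'k) imat"
  assumes "finite I" "\<And>i k. k \<notin> I \<Longrightarrow> a i k = 0"
    and "finite J" "\<And>i k. k \<notin> J \<Longrightarrow> c i k = 0"
  shows "mat_mult (kron a c) (kron b d) = kron (mat_mult a b) (mat_mult c d)"
proof (intro ext)
  fix x y
  have "mat_mult (kron a c) (kron b d) x y = (\<Sum>z\<in>I \<times> J. kron a c x z * kron b d z y)"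
  proof (rule mat_mult_eq_sum)
    show "finite (I \<times> J)" using assms by simp
    show "kron a c u v = 0" if "v \<notin> I \<times> J" for u v
      using that assms(2)[of "fst v" "fst u"] assms(4)[of "snd v" "snd u"]
      by (cases v) (auto simp: kron_def)
  qed
  also have "\<dots> = (\<Sum>k\<in>I. \<Sum>l\<in>J. (a (fst x) k * b k (fst y)) * (c (snd x) l * d l (snd y)))"
    by (simp add: kron_def sum.cartesian_product case_prod_unfold mult_ac)
  also have "\<dots> = kron (mat_mult a b) (mat_mult c d) x y"
    using assms mat_mult_eq_sum[of I a b] mat_mult_eq_sum[of J c d]
    by (simp add: kron_def sum_product)
  finally show "mat_mult (kron a c) (kron b d) x y = kron (mat_mult a b) (mat_mult c d) x y" .
qed

lemma kron_coefficients_zero: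
  fixes B :: "('i, 'k::field) imat set" and C :: "('j, 'k) imat set"
  assumes B: "imat.independent B" "finite B" and C: "imat.independent C" "finite C"
    and eq: "(\<Sum>b\<in>B. \<Sum>c\<in>C. mat_scale (u b c) (kron b c)) = 0" and "b \<in> B" "c \<in> C"
  shows "u b c = 0"
proof -
  have "(\<Sum>c\<in>C. u b c * c k l) = 0" for k l
  proof -
    have "(\<Sum>b\<in>B. mat_scale (\<Sum>c\<in>C. u b c * c k l) b) = 0"
    proof (intro ext)
      fix i j
      have "(\<Sum>b\<in>B. \<Sum>c\<in>C. mat_scale (u b c) (kron b c)) (i, k) (j, l) = 0"
        unfolding eq by simp
      also have "(\<Sum>b\<in>B. \<Sum>c\<in>C. mat_scale (u b c) (kron b c)) (i, k) (j, l)
          = (\<Sum>b\<in>B. \<Sum>c\<in>C. u b c * (b i j * c k l))"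
        by (simp add: sum_fun_apply2 mat_scale_def kron_def)
      also have "\<dots> = (\<Sum>b\<in>B. (\<Sum>c\<in>C. u b c * c k l) * b i j)"
        unfolding sum_distrib_right by (simp only: mult_ac)
      finally show "(\<Sum>b\<in>B. mat_scale (\<Sum>c\<in>C. u b c * c k l) b) i j = (0 :: ('i, 'k) imat) i j"
        by (simp add: sum_fun_apply2 mat_scale_def)
    qed
    from imat.independentD[OF B order.refl this \<open>b \<in> B\<close>] show ?thesis .
  qed
  then have "(\<Sum>c\<in>C. mat_scale (u b c) c) = 0"
    by (intro ext) (simp add: sum_fun_apply2 mat_scale_def)
  from imat.independentD[OF C order.refl this \<open>c \<in> C\<close>] show ?thesis .
qed

lemma inj_on_kron_basis:
  fixes B :: "('i, 'k::field) imat set" and C :: "('j, 'k) imat set"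
  assumes B: "imat.independent B" and C: "imat.independent C"
  shows "inj_on (\<lambda>(b, c). kron b c) (B \<times> C)"
proof (rule inj_onI, clarsimp, rule ccontr)
  fix b c b' c'
  assume bc: "b \<in> B" "c \<in> C" "b' \<in> B" "c' \<in> C" and eq: "kron b c = kron b' c'"
    and ne: "\<not> (b = b' \<and> c = c')"
  define u :: "_ \<Rightarrow> _ \<Rightarrow> 'k" where "u x y = (if x = b \<and> y = c then 1 else 0)
    - (if x = b' \<and> y = c' then 1 else 0)" for x y
  have "(\<Sum>x\<in>{b, b'}. \<Sum>y\<in>{c, c'}. mat_scale (u x y) (kron x y)) = 0"
  proof (cases "b = b'")
    case True
    with ne have "c \<noteq> c'" by simp
    with True eq show ?thesis by (simp add: u_def)
  next
    case False
    with eq show ?thesis by (cases "c = c'") (simp_all add: u_def)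
  qed
  then have "u b c = 0"
    using imat.independent_mono[OF B, of "{b, b'}"] imat.independent_mono[OF C, of "{c, c'}"] bc
    by (intro kron_coefficients_zero[of "{b, b'}" "{c, c'}" u b c]) auto
  then show False using ne by (auto simp: u_def split: if_splits)
qed

lemma independent_kron_basis:
  fixes B :: "('i, 'k::field) imat set" and C :: "('j, 'k) imat set"
  assumes B: "imat.independent B" and C: "imat.independent C"
  shows "imat.independent ((\<lambda>(b, c). kron b c) ` (B \<times> C))"
  unfolding imat.independent_explicit_module
proof clarify
  fix T u v
  assume T: "finite T" "T \<subseteq> (\<lambda>(b, c). kron b c) ` (B \<times> C)"
    and eq: "(\<Sum>v\<in>T. mat_scale (u v) v) = 0" and v: "v \<in> T"
  obtain P where P: "P \<subseteq> B \<times> C" "finite P" "T = (\<lambda>(b, c). kron b c) ` P"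
    using finite_subset_image[OF T] by blast
  have inj: "inj_on (\<lambda>(b, c). kron b c) (B \<times> C)"
    by (rule inj_on_kron_basis[OF B C])
  let ?B = "fst ` P" and ?C = "snd ` P"
  let ?w = "\<lambda>b c. if (b, c) \<in> P then u (kron b c) else 0"
  have sub_B: "?B \<subseteq> B" and sub_C: "?C \<subseteq> C" using P(1) by auto
  have sub: "P \<subseteq> ?B \<times> ?C" by force
  have "(\<Sum>b\<in>?B. \<Sum>c\<in>?C. mat_scale (?w b c) (kron b c))
      = (\<Sum>(b, c)\<in>?B \<times> ?C. mat_scale (?w b c) (kron b c))"
    by (rule sum.cartesian_product)
  also have "\<dots> = (\<Sum>(b, c)\<in>P. mat_scale (u (kron b c)) (kron b c))"
    using P sub by (intro sum.mono_neutral_cong_right) auto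
  also have "\<dots> = (\<Sum>v\<in>T. mat_scale (u v) v)"
    unfolding P(3) by (subst sum.reindex[OF inj_on_subset[OF inj P(1)]]) (simp add: case_prod_unfold)
  finally have z: "(\<Sum>b\<in>?B. \<Sum>c\<in>?C. mat_scale (?w b c) (kron b c)) = 0"
    using eq by simp
  obtain b c where bc: "(b, c) \<in> P" "v = kron b c" using v P(3) by auto
  have "?w b c = 0"
    by (rule kron_coefficients_zero[OF _ _ _ _ z])
      (use P(2) bc imat.independent_mono[OF B, of ?B] imat.independent_mono[OF C, of ?C] sub_B sub_C
        in \<open>auto simp: rev_image_eqI\<close>)
  then show "u v = 0" using bc by simp
qed

lemma tensor_eq_span_basis:
  fixes B :: "('i, 'k::field) imat set" and C :: "('j, 'k) imat set"
  shows "tensor (imat.span B) (imat.span C) = imat.span ((\<lambda>(b, c). kron b c) ` (B \<times> C))"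
proof
  let ?S = "imat.span ((\<lambda>(b, c). kron b c) ` (B \<times> C))"
  have 1: "kron b c \<in> ?S" if b: "b \<in> B" and c: "c \<in> imat.span C" for b c
    using c
  proof (induction rule: imat.span_induct_alt)
    case base
    have "kron b (0 :: ('j, 'k) imat) = 0" by (auto simp: kron_def fun_eq_iff)
    then show ?case by (simp only: imat.span_zero)
  next
    case (step x d e)
    have "kron b (mat_scale x d + e) = mat_scale x (kron b d) + kron b e"
      by (auto simp: kron_def mat_scale_def fun_eq_iff algebra_simps)
    moreover have "kron b d \<in> ?S" using step b by (intro imat.span_base) auto
    ultimately show ?case using step by (simp only: imat.span_add imat.span_scale)
  qed
  have 2: "kron b c \<in> ?S" if b: "b \<in> imat.span B" and c: "c \<in> imat.span C" for b c
    using b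
  proof (induction rule: imat.span_induct_alt)
    case base
    have "kron (0 :: ('i, 'k) imat) c = 0" by (auto simp: kron_def fun_eq_iff)
    then show ?case by (simp only: imat.span_zero)
  next
    case (step x d e)
    have "kron (mat_scale x d + e) c = mat_scale x (kron d c) + kron e c"
      by (auto simp: kron_def mat_scale_def fun_eq_iff algebra_simps)
    then show ?case using step 1 c by (simp only: imat.span_add imat.span_scale)
  qed
  show "tensor (imat.span B) (imat.span C) \<subseteq> ?S"
    unfolding tensor_def using 2 by (intro imat.span_minimal) auto
  show "?S \<subseteq> tensor (imat.span B) (imat.span C)"
    unfolding tensor_def by (intro imat.span_mono) (auto intro: imat.span_base)
qed

end

theory Submission
  imports Defs
begin

text \<open>
  Every nonzero homogeneous matrix of a fine grading is invertible, so replacing the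
  block \<open>x\<close> at position \<open>(k, l)\<close> by \<open>u\<^sub>k\<^sup>-\<^sup>1 \<phi>(x) u\<^sub>l\<close> with homogeneous \<open>u\<^sub>k\<close> shifts the elementary
  degrees by elements of the support; this gives one direction.

  Conversely, under a graded isomorphism the diagonal idempotents \<open>1 \<otimes> e\<^sub>i\<^sub>i\<close> go to idempotents that are
  again primitive in the component of degree \<open>0\<close>. A Krull-Schmidt argument matches them, by a bijection
  \<open>\<tau>\<close> and up to equivalence inside that component, with the diagonal idempotents of the target. Each
  corner between the \<open>i\<close>-th and \<open>j\<close>-th idempotents is thus graded isomorphic to the corner between the \<open>\<tau>(i)\<close>-th and
  \<open>\<tau>(j)\<close>-th. A diagonal corner is the graded algebra \<open>M\<^sub>t\<close>, the vanishing of corners determines the block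
  structure, and the supports of the corners in the first row determine all degrees modulo the support
  of \<open>M\<^sub>t\<close> and one common shift.
\<close>

subsection \<open>Finitely supported matrices\<close>

text \<open>Fineness is used through one fact: \<open>\<Gamma> 0\<close> consists of the multiples
  of \<open>one_mat t\<close>. Hence \<open>e x e\<close> is a multiple of \<open>e\<close> for
  every diagonal idempotent \<open>e\<close> and every \<open>x\<close> of degree 0, and two such
  idempotents are compared by a single scalar \<open>c\<close> with \<open>e f e = c e\<close> and
  \<open>f e f = c f\<close>, nonzero only if they are equivalent. For the two decompositions of the
  identity these scalars form a matrix whose rows and columns sum to 1 and which vanishes between
  different equivalence classes. Adding up the entries of one class counts its rows and also its
  columns, in the field; characteristic zero turns this into an equality of natural numbers. This
  count replaces the exchange argument of Krull-Schmidt. The image of a diagonal idempotent need not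
  be diagonal. No global conjugating unit is built; each corner is corrected separately by degree-0
  elements \<open>a i\<close>, \<open>b i\<close>, which leave all degrees unchanged. The first row
  carries the degree comparison because its corners are nonzero at every column, whatever the block
  sizes.\<close>

notation mat_mult (infixl "\<odot>" 70)

text \<open>\<open>Sum_any\<close> returns 0 when infinitely many terms are nonzero, so over an
  infinite index type the ring laws for \<open>mat_mult\<close> can fail. A single finite set
  bounding rows and columns alike lets every product below become a sum over one index set.\<close>

definition fin_mats :: "('i, 'k::zero) imat set" where
  "fin_mats = {a. \<exists>I. finite I \<and> (\<forall>i j. a i j \<noteq> 0 \<longrightarrow> i \<in> I \<and> j \<in> I)}"

lemma fin_mats_common_support:
  assumes "finite X" "X \<subseteq> fin_mats"
  shows "\<exists>I. finite I \<and> (\<forall>a\<in>X. \<forall>i j. a i j \<noteq> 0 \<longrightarrow> i \<in> I \<and> j \<in> I)"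
  using assms
proof (induction X)
  case (insert a X)
  then obtain I J where "finite I" "\<forall>a\<in>X. \<forall>i j. a i j \<noteq> 0 \<longrightarrow> i \<in> I \<and> j \<in> I"
    "finite J" "\<forall>i j. a i j \<noteq> 0 \<longrightarrow> i \<in> J \<and> j \<in> J"
    by (auto simp: fin_mats_def)
  then show ?case by (intro exI[of _ "I \<union> J"]) auto
qed auto

lemma fin_mats_common_support3:
  fixes a b c :: "('i, 'k::zero) imat"
  assumes "a \<in> fin_mats" "b \<in> fin_mats" "c \<in> fin_mats"
  obtains I where "finite I" "\<And>i j. i \<notin> I \<or> j \<notin> I \<Longrightarrow> a i j = 0"
    "\<And>i j. i \<notin> I \<or> j \<notin> I \<Longrightarrow> b i j = 0" "\<And>i j. i \<notin> I \<or> j \<notin> I \<Longrightarrow> c i j = 0"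
proof -
  obtain I where "finite I" "\<forall>x\<in>{a, b, c}. \<forall>i j. x i j \<noteq> 0 \<longrightarrow> i \<in> I \<and> j \<in> I"
    using fin_mats_common_support[of "{a, b, c}"] assms by auto
  then show thesis by (intro that[of I]) auto
qed

lemma fin_mats_zero [simp, intro]: "0 \<in> fin_mats"
  by (auto simp: fin_mats_def)

lemma fin_mats_mult [simp, intro]: "a \<odot> b \<in> fin_mats"
  and fin_mats_add [simp, intro]: "a + b \<in> fin_mats"
  if a: "a \<in> fin_mats" and b: "b \<in> fin_mats" for a b :: "('i, 'k::field) imat"
proof -
  obtain I where I: "finite I" "\<And>i j. i \<notin> I \<or> j \<notin> I \<Longrightarrow> a i j = 0"
    "\<And>i j. i \<notin> I \<or> j \<notin> I \<Longrightarrow> b i j = 0"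
    using fin_mats_common_support3[OF a b b] by metis
  have *: "(a \<odot> b) i j = 0" if "i \<notin> I \<or> j \<notin> I" for i j
    using I that by (subst mat_mult_eq_sum[of I]) auto
  show "a \<odot> b \<in> fin_mats"
    unfolding fin_mats_def using * I(1) by blast
  show "a + b \<in> fin_mats"
    unfolding fin_mats_def using I(1) I(2,3)
    by (simp, intro exI[of _ I], metis add.right_neutral)
qed

context
  fixes a b c :: "('i, 'k::field) imat"
  assumes a: "a \<in> fin_mats" and b: "b \<in> fin_mats" and c: "c \<in> fin_mats"
begin

lemma mat_mult_assoc: "a \<odot> b \<odot> c = a \<odot> (b \<odot> c)"
proof (intro ext)
  fix i j
  obtain I where I: "finite I" "\<And>i j. i \<notin> I \<or> j \<notin> I \<Longrightarrow> a i j = 0"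
    "\<And>i j. i \<notin> I \<or> j \<notin> I \<Longrightarrow> b i j = 0"
    using fin_mats_common_support3[OF a b c] by metis
  have ab: "(a \<odot> b) i k = (\<Sum>l\<in>I. a i l * b l k)" for i k
    using I by (intro mat_mult_eq_sum) auto
  have "(a \<odot> b \<odot> c) i j = (\<Sum>k\<in>I. (a \<odot> b) i k * c k j)"
    using I by (intro mat_mult_eq_sum) (auto simp: ab)
  also have "\<dots> = (\<Sum>l\<in>I. a i l * (\<Sum>k\<in>I. b l k * c k j))"
    unfolding ab sum_distrib_left sum_distrib_right by (subst sum.swap) (simp add: mult.assoc)
  also have "\<dots> = (\<Sum>l\<in>I. a i l * (b \<odot> c) l j)"
    using I by (intro sum.cong refl arg_cong2[where f = "(*)"] mat_mult_eq_sum[symmetric]) auto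
  also have "\<dots> = (a \<odot> (b \<odot> c)) i j"
    using I by (intro mat_mult_eq_sum[symmetric]) auto
  finally show "(a \<odot> b \<odot> c) i j = (a \<odot> (b \<odot> c)) i j" .
qed

lemma mat_mult_add_left: "(a + b) \<odot> c = a \<odot> c + b \<odot> c"
  and mat_mult_add_right: "a \<odot> (b + c) = a \<odot> b + a \<odot> c"
proof -
  obtain I where I: "finite I" "\<And>i j. i \<notin> I \<or> j \<notin> I \<Longrightarrow> a i j = 0"
    "\<And>i j. i \<notin> I \<or> j \<notin> I \<Longrightarrow> b i j = 0"
    using fin_mats_common_support3[OF a b c] by metis
  then have *: "(x \<odot> y) i j = (\<Sum>l\<in>I. x i l * y l j)" if "x \<in> {a, b, a + b}" for x y i j
    using that by (intro mat_mult_eq_sum) auto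
  show "(a + b) \<odot> c = a \<odot> c + b \<odot> c" "a \<odot> (b + c) = a \<odot> b + a \<odot> c"
    by (auto simp: fun_eq_iff * algebra_simps sum.distrib)
qed

end

lemma fin_mats_scale [simp, intro]: "a \<in> fin_mats \<Longrightarrow> mat_scale c a \<in> fin_mats"
  for a :: "('i, 'k::field) imat"
  by (auto simp: fin_mats_def mat_scale_def)

lemma fin_mats_sum [simp, intro]: "(\<And>x. x \<in> X \<Longrightarrow> F x \<in> fin_mats) \<Longrightarrow> sum F X \<in> fin_mats"
  for F :: "'x \<Rightarrow> ('i, 'k::field) imat"
  by (induction X rule: infinite_finite_induct) auto

lemma mat_mult_zero [simp]: "0 \<odot> a = 0" "a \<odot> 0 = 0"
  for a :: "('i, 'k::field) imat"
  by (auto simp: mat_mult_def fun_eq_iff)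

lemma mat_mult_scale_left [simp]: "a \<in> fin_mats \<Longrightarrow> mat_scale c a \<odot> b = mat_scale c (a \<odot> b)"
  for a :: "('i, 'k::field) imat"
proof (intro ext)
  fix i j assume "a \<in> fin_mats"
  then obtain I where I: "finite I" "\<forall>i j. a i j \<noteq> 0 \<longrightarrow> i \<in> I \<and> j \<in> I"
    by (auto simp: fin_mats_def)
  have "(mat_scale c a \<odot> b) i j = (\<Sum>l\<in>I. mat_scale c a i l * b l j)"
    "(a \<odot> b) i j = (\<Sum>l\<in>I. a i l * b l j)"
    using I by (auto intro!: mat_mult_eq_sum simp: mat_scale_def)
  then show "(mat_scale c a \<odot> b) i j = mat_scale c (a \<odot> b) i j"
    by (simp add: mat_scale_def sum_distrib_left mult.assoc)
qed

lemma mat_mult_scale_right [simp]: "a \<in> fin_mats \<Longrightarrow> a \<odot> mat_scale c b = mat_scale c (a \<odot> b)"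
  for a :: "('i, 'k::field) imat"
proof (intro ext)
  fix i j assume "a \<in> fin_mats"
  then obtain I where I: "finite I" "\<forall>i j. a i j \<noteq> 0 \<longrightarrow> i \<in> I \<and> j \<in> I"
    by (auto simp: fin_mats_def)
  have *: "(a \<odot> x) i j = (\<Sum>l\<in>I. a i l * x l j)" for x i j
    using I by (intro mat_mult_eq_sum) auto
  show "(a \<odot> mat_scale c b) i j = mat_scale c (a \<odot> b) i j"
    by (auto simp: mat_scale_def * sum_distrib_left mult_ac)
qed

lemma mat_mult_sum_left:
  "b \<in> fin_mats \<Longrightarrow> (\<And>x. x \<in> X \<Longrightarrow> F x \<in> fin_mats) \<Longrightarrow> sum F X \<odot> b = (\<Sum>x\<in>X. F x \<odot> b)"
  for F :: "'x \<Rightarrow> ('i, 'k::field) imat"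
  by (induction X rule: infinite_finite_induct) (simp_all add: mat_mult_add_left)

lemma mat_mult_sum_right:
  "b \<in> fin_mats \<Longrightarrow> (\<And>x. x \<in> X \<Longrightarrow> F x \<in> fin_mats) \<Longrightarrow> b \<odot> sum F X = (\<Sum>x\<in>X. b \<odot> F x)"
  for F :: "'x \<Rightarrow> ('i, 'k::field) imat"
  by (induction X rule: infinite_finite_induct) (simp_all add: mat_mult_add_right)

subsection \<open>Fine gradings of matrix algebras\<close>

definition one_mat :: "nat \<Rightarrow> (nat, 'k::zero_neq_one) imat" where
  "one_mat t = (\<lambda>i j. if i = j \<and> i \<in> {1..t} then 1 else 0)"

lemma fin_mats_matrix_algebra: "a \<in> matrix_algebra t \<Longrightarrow> a \<in> fin_mats"
  unfolding matrix_algebra_def fin_mats_def mem_Collect_eq by (intro exI[of _ "{1..t}"]) blast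

lemma matrix_algebra_zero:
  "a \<in> matrix_algebra t \<Longrightarrow> i \<notin> {1..t} \<or> j \<notin> {1..t} \<Longrightarrow> a i j = 0"
  unfolding matrix_algebra_def by blast

lemma subspace_matrix_algebra: "imat.subspace (matrix_algebra t)"
  by (rule imat.subspaceI) (auto simp: matrix_algebra_def mat_scale_def)

lemma mat_mult_matrix_algebra_eq:
  "a \<in> matrix_algebra t \<Longrightarrow> (a \<odot> b) i j = (\<Sum>l\<in>{1..t}. a i l * b l j)"
  for a :: "(nat, 'k::field) imat"
  by (intro mat_mult_eq_sum) (blast intro: matrix_algebra_zero)+

lemma matrix_algebra_mult:
  "a \<in> matrix_algebra t \<Longrightarrow> b \<in> matrix_algebra t \<Longrightarrow> a \<odot> b \<in> matrix_algebra t"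
  for a b :: "(nat, 'k::field) imat"
  unfolding matrix_algebra_def[of t] mem_Collect_eq
  by (subst mat_mult_eq_sum[of "{1..t}"]) (auto intro!: sum.neutral simp del: atLeastAtMost_iff)

lemma one_mat_in [simp]: "one_mat t \<in> matrix_algebra t"
  by (auto simp: one_mat_def matrix_algebra_def)

lemma one_mat_mult [simp]: "a \<in> matrix_algebra t \<Longrightarrow> one_mat t \<odot> a = a"
  and mult_one_mat [simp]: "a \<in> matrix_algebra t \<Longrightarrow> a \<odot> one_mat t = a"
  for a :: "(nat, 'k::field) imat"
proof -
  assume a: "a \<in> matrix_algebra t"
  have *: "(one_mat t \<odot> a) i j = (if i \<in> {1..t} then a i j else 0)" for i j
    unfolding mat_mult_matrix_algebra_eq[OF one_mat_in]
    by (auto simp: one_mat_def if_distrib[of "\<lambda>x. x * _"] cong: if_cong simp del: atLeastAtMost_iff)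
  show "one_mat t \<odot> a = a"
    using matrix_algebra_zero[OF a] by (auto simp: fun_eq_iff *)
  have *: "(a \<odot> one_mat t) i j = (if j \<in> {1..t} then a i j else 0)" for i j
    unfolding mat_mult_matrix_algebra_eq[OF a]
    by (auto simp: one_mat_def if_distrib[of "\<lambda>x. _ * x"] cong: if_cong simp del: atLeastAtMost_iff)
  show "a \<odot> one_mat t = a"
    using matrix_algebra_zero[OF a] by (auto simp: fun_eq_iff *)
qed

lemma matrix_unit_in: "i \<in> {1..t} \<Longrightarrow> j \<in> {1..t} \<Longrightarrow> matrix_unit i j \<in> matrix_algebra t"
  by (auto simp: matrix_unit_def matrix_algebra_def)

text \<open>Simplicity of the matrix algebra in usable form: one nonzero entry of \<open>x\<close>
  puts every diagonal matrix unit into the ideal generated by \<open>x\<close>, hence also their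
  sum, the identity.\<close>

lemma matrix_unit_sandwich:
  fixes x :: "(nat, 'k::field) imat"
  assumes "x \<in> matrix_algebra t" "{i, j, k} \<subseteq> {1..t}"
  shows "matrix_unit k i \<odot> x \<odot> matrix_unit j k = mat_scale (x i j) (matrix_unit k k)"
proof -
  have u: "matrix_unit k i \<in> matrix_algebra t"
    using assms by (intro matrix_unit_in) auto
  have *: "(matrix_unit k i \<odot> x) r s = (if r = k then x i s else 0)" for r s
    unfolding mat_mult_matrix_algebra_eq[OF u] using assms(2)
    by (auto simp: matrix_unit_def if_distrib[of "\<lambda>x. x * _"] cong: if_cong)
  have "(matrix_unit k i \<odot> x \<odot> matrix_unit j k) r s
      = (if r = k \<and> s = k then x i j else 0)" for r s
    unfolding mat_mult_matrix_algebra_eq[OF matrix_algebra_mult[OF u assms(1)]] * using assms(2)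
    by (auto simp: matrix_unit_def if_distrib[of "\<lambda>x. _ * x"] cong: if_cong)
  then show ?thesis
    by (auto simp: fun_eq_iff mat_scale_def matrix_unit_def)
qed

text \<open>Ensures that a basis of a component is finite, without which the bound on
  \<open>imat.dim\<close> in \<open>is_fine\<close> would say nothing about its size.\<close>

lemma finite_basis_matrix_algebra:
  "\<exists>B. finite B \<and> matrix_algebra t \<subseteq> imat.span (B :: (nat, 'k::field) imat set)"
proof (intro exI conjI subsetI)
  let ?B = "(\<lambda>(i, j). matrix_unit i j) ` ({1..t} \<times> {1..t}) :: (nat, 'k) imat set"
  show "finite ?B" by simp
  fix a :: "(nat, 'k) imat" assume a: "a \<in> matrix_algebra t"
  have "a = (\<Sum>(i, j)\<in>{1..t} \<times> {1..t}. mat_scale (a i j) (matrix_unit i j))"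
  proof (intro ext)
    fix k l
    have "(\<Sum>(i, j)\<in>{1..t} \<times> {1..t}. mat_scale (a i j) (matrix_unit i j)) k l
      = (\<Sum>x\<in>{1..t} \<times> {1..t}. if x = (k, l) then a k l else 0)"
      unfolding sum_fun_apply2 by (intro sum.cong) (auto simp: mat_scale_def matrix_unit_def split: if_splits)
    also have "\<dots> = a k l"
      using matrix_algebra_zero[OF a] by auto
    finally show "a k l = (\<Sum>(i, j)\<in>{1..t} \<times> {1..t}. mat_scale (a i j) (matrix_unit i j)) k l" ..
  qed
  also have "\<dots> \<in> imat.span ?B"
    unfolding case_prod_unfold by (intro imat.span_sum imat.span_scale imat.span_base) auto
  finally show "a \<in> imat.span ?B" .
qed

section \<open>Homogeneous elements of a fine grading: unit, scalars, inverses\<close>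

locale fine_matrix_grading =
  fixes t :: nat and \<Gamma> :: "'g::{finite, ab_group_add} \<Rightarrow> (nat, 'k::field) imat set"
  assumes t_pos: "t \<ge> 1" and grading: "is_grading (matrix_algebra t) \<Gamma>" and fine: "is_fine \<Gamma>"
begin

lemma subspace_component: "imat.subspace (\<Gamma> g)"
  and component_matrix_algebra: "a \<in> \<Gamma> g \<Longrightarrow> a \<in> matrix_algebra t"
  and component_mult: "a \<in> \<Gamma> g \<Longrightarrow> b \<in> \<Gamma> h \<Longrightarrow> a \<odot> b \<in> \<Gamma> (g + h)"
  and decomposition: "c \<in> matrix_algebra t \<Longrightarrow> \<exists>f. (\<forall>g. f g \<in> \<Gamma> g) \<and> c = (\<Sum>g\<in>UNIV. f g)"
  using grading unfolding is_grading_def by (blast dest: bspec ex1_implies_ex)+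

lemma component_fin_mats: "a \<in> \<Gamma> g \<Longrightarrow> a \<in> fin_mats"
  using component_matrix_algebra fin_mats_matrix_algebra by blast

lemmas component_zero = imat.subspace_0[OF subspace_component]
  and component_scale = imat.subspace_scale[OF subspace_component]

lemma decomposition_unique:
  assumes f: "\<And>g. f g \<in> \<Gamma> g" and f': "\<And>g. f' g \<in> \<Gamma> g" and eq: "(\<Sum>g\<in>UNIV. f g) = (\<Sum>g\<in>UNIV. f' g)"
  shows "f g = f' g"
proof -
  have "(\<Sum>g\<in>UNIV. f g) \<in> matrix_algebra t"
    using f component_matrix_algebra by (blast intro: imat.subspace_sum[OF subspace_matrix_algebra])
  then have "\<exists>!h. (\<forall>g. h g \<in> \<Gamma> g) \<and> (\<Sum>g\<in>UNIV. f g) = (\<Sum>g\<in>UNIV. h g)"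
    using grading unfolding is_grading_def by blast
  then show ?thesis using f f' eq by metis
qed

lemma single_component:
  assumes "x \<in> \<Gamma> h" "\<And>g. f g \<in> \<Gamma> g" "x = (\<Sum>g\<in>UNIV. f g)"
  shows "f g = (if g = h then x else 0)"
proof (rule decomposition_unique[of f])
  show "(\<Sum>g\<in>UNIV. f g) = (\<Sum>g\<in>UNIV. if g = h then x else 0)"
    by (simp flip: assms(3))
  show "(if g = h then x else 0) \<in> \<Gamma> g" for g
    using assms(1) component_zero[of g] by presburger
qed (rule assms(2))

lemma one_mat_neq_0: "one_mat t \<noteq> (0 :: (nat, 'k) imat)"
  using t_pos by (auto simp: one_mat_def fun_eq_iff intro!: exI[of _ 1])

text \<open>The degree-0 part \<open>e 0\<close> of the identity is a left unit for every
  homogeneous \<open>x\<close>, since the other parts move \<open>x\<close> to other degrees.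
  Multiplying it with the decomposition of the identity then gives
  \<open>e 0 = one_mat t\<close>.\<close>

lemma one_mat_component: "one_mat t \<in> \<Gamma> 0"
proof -
  obtain e where e: "\<And>g. e g \<in> \<Gamma> g" and one: "one_mat t = (\<Sum>g\<in>UNIV. e g)"
    using decomposition[OF one_mat_in] by blast
  have *: "e 0 \<odot> x = x" if x: "x \<in> \<Gamma> h" for x h
  proof -
    have "x = one_mat t \<odot> x" using component_matrix_algebra[OF x] by simp
    also have "\<dots> = (\<Sum>g\<in>UNIV. e g \<odot> x)"
      unfolding one using e x component_fin_mats by (intro mat_mult_sum_left) blast+
    \<comment> \<open>After the shift of the index the term at \<open>g\<close> has degree
      \<open>g\<close>, so this is the homogeneous decomposition of \<open>x\<close>, and the term
      at \<open>h\<close> must be \<open>x\<close> itself.\<close>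
    also have "\<dots> = (\<Sum>g\<in>UNIV. e (g - h) \<odot> x)"
      by (rule sum.reindex_bij_witness[of _ "\<lambda>g. g - h" "\<lambda>g. g + h"]) auto
    finally have "e (h - h) \<odot> x = (if h = h then x else 0)"
      using component_mult[OF e x, of "_ - h"] x
      by (intro single_component[of x h "\<lambda>g. e (g - h) \<odot> x"]) auto
    then show ?thesis by simp
  qed
  have "e 0 = e 0 \<odot> one_mat t" using component_matrix_algebra[OF e] by simp
  also have "\<dots> = (\<Sum>g\<in>UNIV. e 0 \<odot> e g)"
    unfolding one using e component_fin_mats by (intro mat_mult_sum_right) blast+
  also have "\<dots> = one_mat t"
    unfolding one using * e by (intro sum.cong) auto
  finally show ?thesis using e by metis
qed

lemma component_one_dim:
  assumes "x \<in> \<Gamma> g" "x \<noteq> 0" "y \<in> \<Gamma> g"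
  shows "\<exists>c. y = mat_scale c x"
proof -
  have "imat.independent {x}" using assms by (simp add: imat.dependent_single)
  then obtain B where B: "{x} \<subseteq> B" "B \<subseteq> \<Gamma> g" "imat.independent B" "\<Gamma> g \<subseteq> imat.span B"
    using imat.maximal_independent_subset_extend[of "{x}" "\<Gamma> g"] assms by auto
  obtain C :: "(nat, 'k) imat set" where C: "finite C" "matrix_algebra t \<subseteq> imat.span C"
    using finite_basis_matrix_algebra by blast
  \<comment> \<open>Finiteness first: for an infinite \<open>B\<close> the bound
    \<open>card B \<le> 1\<close> would hold trivially, because \<open>card\<close> is 0
    there.\<close>
  have "finite B"
    using imat.independent_span_bound[OF C(1) B(3)] B(2) C(2) component_matrix_algebra by blast
  moreover have "card B \<le> 1"
    using imat.basis_card_eq_dim[OF B(2,4,3)] fine by (simp add: is_fine_def)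
  ultimately have "B = {x}"
    using B(1) card_seteq[of B "{x}"] by simp
  then show ?thesis using B(4) assms(3) by (auto simp: imat.span_singleton)
qed

lemma component_0: "x \<in> \<Gamma> 0 \<Longrightarrow> \<exists>c. x = mat_scale c (one_mat t)"
  using component_one_dim[OF one_mat_component one_mat_neq_0] .

text \<open>By simplicity of the matrix algebra, \<open>1\<close> lies in the ideal generated by \<open>x\<close>; comparing
  components of degree \<open>0\<close> gives a homogeneous sandwich.\<close>

lemma homogeneous_sandwich:
  assumes x: "x \<in> \<Gamma> g" and "x \<noteq> 0"
  obtains (sandwich) h a b where "a \<in> \<Gamma> h" "b \<in> \<Gamma> (- h - g)" "a \<odot> x \<odot> b \<noteq> 0"
proof (rule ccontr)
  assume "\<not> thesis"
  then have no: "a \<odot> x \<odot> b = 0" if "a \<in> \<Gamma> h" "b \<in> \<Gamma> (- h - g)" for a b h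
    using sandwich that by blast
  \<comment> \<open>\<open>Z\<close> collects the matrices with zero component in degree 0. If all
    sandwiches of total degree 0 vanish, the whole two-sided ideal of \<open>x\<close> falls into
    \<open>Z\<close>, and with it the identity, which is nonzero of degree 0.\<close>
  define Z where "Z = {\<Sum>g\<in>UNIV. f g | f. (\<forall>g. f g \<in> \<Gamma> g) \<and> f 0 = 0}"
  have Z: "imat.subspace Z"
  proof (rule imat.subspaceI)
    show "0 \<in> Z" unfolding Z_def using component_zero by (intro CollectI exI[of _ "\<lambda>_. 0"]) auto
  next
    fix y z assume "y \<in> Z" "z \<in> Z"
    then obtain f f' where *: "\<forall>g. f g \<in> \<Gamma> g" "f 0 = 0" "y = (\<Sum>g\<in>UNIV. f g)"
      "\<forall>g. f' g \<in> \<Gamma> g" "f' 0 = 0" "z = (\<Sum>g\<in>UNIV. f' g)" unfolding Z_def by blast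
    then show "y + z \<in> Z" unfolding Z_def
      using imat.subspace_add[OF subspace_component]
      by (intro CollectI exI[of _ "\<lambda>g. f g + f' g"]) (auto simp: sum.distrib)
  next
    fix c y assume "y \<in> Z"
    then obtain f where *: "\<forall>g. f g \<in> \<Gamma> g" "f 0 = 0" "y = (\<Sum>g\<in>UNIV. f g)" unfolding Z_def by blast
    then show "mat_scale c y \<in> Z" unfolding Z_def using component_scale
      by (intro CollectI exI[of _ "\<lambda>g. mat_scale c (f g)"]) (auto simp: imat.scale_sum_right)
  qed
  have in_Z: "y \<in> Z" if "y \<in> \<Gamma> h" "h = 0 \<longrightarrow> y = 0" for y h
    unfolding Z_def using that component_zero
    by (intro CollectI exI[of _ "\<lambda>g. if g = h then y else 0"]) auto
  have axb_in_Z: "a \<odot> x \<odot> b \<in> Z" if a: "a \<in> matrix_algebra t" and b: "b \<in> matrix_algebra t" for a b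
  proof -
    obtain u v where u: "\<And>g. u g \<in> \<Gamma> g" "a = (\<Sum>g\<in>UNIV. u g)"
      and v: "\<And>g. v g \<in> \<Gamma> g" "b = (\<Sum>g\<in>UNIV. v g)"
      using decomposition[OF a] decomposition[OF b] by metis
    have fin: "x \<in> fin_mats" "u g \<in> fin_mats" "v g \<in> fin_mats" for g
      using x u v component_fin_mats by blast+
    have "a \<odot> x \<odot> b = (\<Sum>g\<in>UNIV. \<Sum>h\<in>UNIV. u g \<odot> x \<odot> v h)"
      unfolding u v by (subst sum.swap) (simp add: mat_mult_sum_left mat_mult_sum_right fin)
    \<comment> \<open>Only the pairs with \<open>g' + g + h = 0\<close> land in degree 0, and those
      products vanish by \<open>no\<close>; every other product lies in \<open>Z\<close> by its
      degree.\<close>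
    moreover have "u g' \<odot> x \<odot> v h \<in> Z" for g' h
    proof (rule in_Z[OF component_mult[OF component_mult[OF u(1) x] v(1)]], rule impI)
      assume "g' + g + h = 0"
      then have "h = - g' - g" using minus_unique by fastforce
      then show "u g' \<odot> x \<odot> v h = 0" using no[OF u(1) v(1)] by blast
    qed
    ultimately show ?thesis by (auto intro!: imat.subspace_sum[OF Z])
  qed
  obtain i j where ij: "x i j \<noteq> 0" using \<open>x \<noteq> 0\<close> by (auto simp: fun_eq_iff)
  have xt: "x \<in> matrix_algebra t" using x component_matrix_algebra by blast
  with ij have ijt: "i \<in> {1..t}" "j \<in> {1..t}" unfolding matrix_algebra_def by blast+
  have "mat_scale (x i j) (matrix_unit k k) \<in> Z" if "k \<in> {1..t}" for k
    using axb_in_Z[of "matrix_unit k i" "matrix_unit j k"] matrix_unit_sandwich[OF xt, of i j k]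
      that ijt matrix_unit_in by auto
  then have "mat_scale (inverse (x i j)) (mat_scale (x i j) (matrix_unit k k)) \<in> Z" if "k \<in> {1..t}" for k
    using that imat.subspace_scale[OF Z] by blast
  then have "(\<Sum>k\<in>{1..t}. matrix_unit k k) \<in> Z"
    using ij by (intro imat.subspace_sum[OF Z]) simp
  also have "(\<Sum>k\<in>{1..t}. matrix_unit k k) = one_mat t"
    by (auto simp: fun_eq_iff sum_fun_apply2 matrix_unit_def one_mat_def intro!: sum.neutral)
  finally obtain f where f: "\<And>g. f g \<in> \<Gamma> g" "f 0 = 0" "one_mat t = (\<Sum>g\<in>UNIV. f g)"
    unfolding Z_def by auto
  from single_component[OF one_mat_component f(1,3), of 0] f(2) one_mat_neq_0 show False by simp
qed

text \<open>The sandwich \<open>a x b\<close> is a nonzero scalar \<open>c\<close>, as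
  \<open>\<Gamma> 0\<close> contains scalars only. So \<open>b a\<close>, of degree
  \<open>- g\<close>, is an inverse up to scale: squaring the sandwich shows that
  \<open>b a x\<close> is a nonzero scalar too, and computing \<open>x b a x\<close> in two ways
  shows that \<open>b a\<close> multiplies \<open>x\<close> to the same scalar from both
  sides.\<close>

lemma homogeneous_inverse:
  assumes x: "x \<in> \<Gamma> g" and "x \<noteq> 0"
  obtains y where "y \<in> \<Gamma> (- g)" "x \<odot> y = one_mat t" "y \<odot> x = one_mat t"
proof -
  obtain h a b where ab: "a \<in> \<Gamma> h" "b \<in> \<Gamma> (- h - g)" "a \<odot> x \<odot> b \<noteq> 0"
    using homogeneous_sandwich[OF assms] .
  have fin: "a \<in> fin_mats" "b \<in> fin_mats" "x \<in> fin_mats" using ab x component_fin_mats by blast+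
  note A = ab(1,2)[THEN component_matrix_algebra] component_matrix_algebra[OF x] matrix_algebra_mult
  have ba: "b \<odot> a \<in> \<Gamma> (- g)" using component_mult[OF ab(2,1)] by simp
  have "a \<odot> x \<odot> b \<in> \<Gamma> 0" "b \<odot> a \<odot> x \<in> \<Gamma> 0" "x \<odot> (b \<odot> a) \<in> \<Gamma> 0"
    using component_mult[OF component_mult[OF ab(1) x] ab(2)] component_mult[OF ba x]
      component_mult[OF x ba] by (simp_all add: algebra_simps)
  then obtain c d e where c: "a \<odot> x \<odot> b = mat_scale c (one_mat t)"
    and d: "b \<odot> a \<odot> x = mat_scale d (one_mat t)" and e: "x \<odot> (b \<odot> a) = mat_scale e (one_mat t)"
    using component_0 by meson
  have "c \<noteq> 0" using c ab(3) by auto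
  have o: "one_mat t \<in> (fin_mats :: (nat, 'k) imat set)" using fin_mats_matrix_algebra one_mat_in by blast
  have "mat_scale (c * c) (one_mat t) = (a \<odot> x \<odot> b) \<odot> (a \<odot> x \<odot> b)"
    unfolding c by (simp add: o)
  also have "\<dots> = a \<odot> x \<odot> (b \<odot> a \<odot> x) \<odot> b"
    by (simp add: mat_mult_assoc fin)
  also have "\<dots> = mat_scale (d * c) (one_mat t)" unfolding d
    using c by (simp add: fin o A)
  finally have "c * c = d * c" using one_mat_neq_0 by (simp add: imat.scale_right_imp_eq)
  then have "d \<noteq> 0" using \<open>c \<noteq> 0\<close> by auto
  have "mat_scale e (x \<odot> one_mat t) = mat_scale d x"
  proof -
    have "mat_scale e x = x \<odot> (b \<odot> a) \<odot> x" unfolding e by (simp add: fin o A)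
    also have "\<dots> = x \<odot> (b \<odot> a \<odot> x)" by (simp add: mat_mult_assoc fin)
    also have "\<dots> = mat_scale d x" unfolding d by (simp add: fin o A)
    finally show ?thesis by (simp add: A)
  qed
  then have "e = d" using \<open>x \<noteq> 0\<close> by (simp add: A)
  show thesis
  proof (rule that)
    show "mat_scale (inverse d) (b \<odot> a) \<in> \<Gamma> (- g)" using ba by (rule component_scale)
    show "x \<odot> mat_scale (inverse d) (b \<odot> a) = one_mat t" "mat_scale (inverse d) (b \<odot> a) \<odot> x = one_mat t"
      using d e \<open>e = d\<close> \<open>d \<noteq> 0\<close> by (simp_all add: fin)
  qed
qed

end

subsection \<open>Block decomposition of the tensor product\<close>

definition slice :: "('i \<times> 'j, 'k) imat \<Rightarrow> 'j \<Rightarrow> 'j \<Rightarrow> ('i, 'k) imat" where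
  "slice a k l = (\<lambda>i j. a (i, k) (j, l))"

text \<open>Both the tensor product and its homogeneous components take this form, which replaces
  membership in a span by a condition on each block separately.\<close>

definition block_matrices :: "('j \<Rightarrow> 'j \<Rightarrow> ('i, 'k) imat set) \<Rightarrow> ('i \<times> 'j, 'k) imat set" where
  "block_matrices X = {a. \<forall>k l. slice a k l \<in> X k l}"

definition emb :: "'j \<Rightarrow> 'j \<Rightarrow> ('i, 'k::field) imat \<Rightarrow> ('i \<times> 'j, 'k) imat" where
  "emb k l x = kron x (matrix_unit k l)"

lemma slice_eqI: "(\<And>k l. slice a k l = slice b k l) \<Longrightarrow> a = b"
  by (simp add: slice_def fun_eq_iff)

lemma slice_linear [simp]:
  fixes a b :: "('i \<times> 'j, 'k::field) imat"
  shows "slice (a + b) k l = slice a k l + slice b k l"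
    "slice (mat_scale c a) k l = mat_scale c (slice a k l)" "slice (0 :: ('i \<times> 'j, 'k) imat) k l = 0"
  by (simp_all add: slice_def mat_scale_def fun_eq_iff)

lemma slice_sum: "slice (\<Sum>x\<in>X. F x) k l = (\<Sum>x\<in>X. slice (F x) k l)"
  for F :: "'x \<Rightarrow> ('i \<times> 'j, 'k::field) imat"
  by (simp add: slice_def fun_eq_iff sum_fun_apply2)

lemma slice_kron: "slice (kron a b) k l = mat_scale (b k l) (a :: ('i, 'k::field) imat)"
  by (simp add: slice_def kron_def mat_scale_def fun_eq_iff mult.commute)

lemma slice_emb: "slice (emb k l x) k' l' = (if k' = k \<and> l' = l then x else 0)"
  by (simp add: emb_def slice_kron matrix_unit_def)

lemma slice_emb_same [simp]: "slice (emb k l x) k l = x"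
  by (simp add: slice_emb)

lemma emb_linear:
  "emb k l (x + y) = emb k l x + emb k l y" "emb k l (mat_scale c x) = mat_scale c (emb k l x)"
  "emb k l 0 = 0"
  by (rule slice_eqI; simp add: slice_emb)+

text \<open>Multiplication of block matrices. \<open>N\<close> bounds the outer summation index
  along row \<open>k\<close> of \<open>a\<close>, and the finite support of \<open>a\<close> bounds
  the inner one, so \<open>Sum_any\<close> becomes a finite double sum.\<close>

lemma slice_mult:
  fixes a b :: "('i \<times> 'j, 'k::field) imat"
  assumes "a \<in> fin_mats" "finite N" and N: "\<And>m. m \<notin> N \<Longrightarrow> slice a k m = 0"
  shows "slice (a \<odot> b) k l = (\<Sum>m\<in>N. slice a k m \<odot> slice b m l)"
proof (intro ext)
  fix i j
  obtain I where I: "finite I" "\<And>x y. a x y \<noteq> 0 \<Longrightarrow> x \<in> I \<and> y \<in> I"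
    using assms(1) by (auto simp: fin_mats_def)
  have supp: "a (i, k) (r, m) = 0" if "r \<notin> fst ` I \<or> m \<notin> N" for r m i
    using that I(2)[of "(i, k)" "(r, m)"] N[of m] by (force simp: slice_def fun_eq_iff)
  have "slice (a \<odot> b) k l i j = Sum_any (\<lambda>z. a (i, k) z * b z (j, l))"
    by (simp add: slice_def mat_mult_def)
  also have "\<dots> = (\<Sum>z\<in>fst ` I \<times> N. a (i, k) z * b z (j, l))"
    using supp I(1) assms(2) by (intro Sum_any.expand_superset) auto
  also have "\<dots> = (\<Sum>m\<in>N. \<Sum>r\<in>fst ` I. slice a k m i r * slice b m l r j)"
    by (subst sum.swap) (simp add: sum.cartesian_product slice_def case_prod_unfold)
  also have "\<dots> = (\<Sum>m\<in>N. (slice a k m \<odot> slice b m l) i j)"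
    using supp I(1) by (intro sum.cong refl mat_mult_eq_sum[symmetric]) (auto simp: slice_def)
  finally show "slice (a \<odot> b) k l i j = (\<Sum>m\<in>N. slice a k m \<odot> slice b m l) i j"
    by (simp add: sum_fun_apply2)
qed

lemma subspace_block_matrices:
  "(\<And>k l. imat.subspace (X k l)) \<Longrightarrow> imat.subspace (block_matrices X)"
  unfolding imat.subspace_def block_matrices_def by simp

lemma sum_emb_slice:
  fixes a :: "('i \<times> 'j, 'k::field) imat"
  assumes Q: "finite Q" and a: "\<And>k l. (k, l) \<notin> Q \<Longrightarrow> slice a k l = 0"
  shows "(\<Sum>(i, j)\<in>Q. emb i j (slice a i j)) = a"
proof (rule slice_eqI)
  fix k l
  have "slice (\<Sum>(i, j)\<in>Q. emb i j (slice a i j)) k l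
      = (\<Sum>x\<in>Q. slice (emb (fst x) (snd x) (slice a (fst x) (snd x))) k l)"
    by (simp only: slice_sum case_prod_unfold)
  also have "\<dots> = (\<Sum>x\<in>Q. if x = (k, l) then slice a k l else 0)"
    by (intro sum.cong) (auto simp: slice_emb)
  also have "\<dots> = slice a k l"
    using a[of k l] Q by (cases "(k, l) \<in> Q") simp_all
  finally show "slice (\<Sum>(i, j)\<in>Q. emb i j (slice a i j)) k l = slice a k l" .
qed

text \<open>The matrix units are a basis of the second factor, so an element of the tensor product
  amounts to a free choice of a coefficient from \<open>A\<close> at each position in
  \<open>Q\<close>. This serves the whole algebra (\<open>Q\<close> all admissible positions) as
  well as one elementary degree (\<open>Q\<close> the positions of that degree).\<close>

lemma tensor_span_matrix_units:
  fixes A :: "('i, 'k::field) imat set"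
  assumes A: "imat.subspace A" and Q: "finite Q"
  shows "tensor A (imat.span {matrix_unit i j | i j. (i :: 'j, j) \<in> Q})
    = block_matrices (\<lambda>k l. if (k, l) \<in> Q then A else {0})"
proof
  let ?U = "{matrix_unit i j | i j. (i, j) \<in> Q} :: ('j, 'k) imat set"
  let ?X = "\<lambda>k l. if (k, l) \<in> Q then A else {0}"
  have sub: "imat.subspace (block_matrices ?X)"
    using A by (intro subspace_block_matrices) simp
  have "b k l = 0" if "b \<in> imat.span ?U" "(k, l) \<notin> Q" for b :: "('j, 'k) imat" and k l
    using that
  proof (induction rule: imat.span_induct_alt)
    case (step c x y)
    then show ?case by (auto simp: mat_scale_def matrix_unit_def split: if_splits)
  qed simp
  then have "kron a b \<in> block_matrices ?X" if "a \<in> A" "b \<in> imat.span ?U" for a b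
    using that imat.subspace_scale[OF A] unfolding block_matrices_def by (simp add: slice_kron)
  then show "tensor A (imat.span ?U) \<subseteq> block_matrices ?X"
    unfolding tensor_def by (intro imat.span_minimal sub) auto
  show "block_matrices ?X \<subseteq> tensor A (imat.span ?U)"
  proof
    fix a assume a: "a \<in> block_matrices ?X"
    have "a = (\<Sum>(i, j)\<in>Q. emb i j (slice a i j))"
      using a by (intro sum_emb_slice[OF Q, symmetric]) (simp add: block_matrices_def, metis singletonD)
    also have "\<dots> \<in> tensor A (imat.span ?U)"
    proof -
      have "emb i j (slice a i j) \<in> tensor A (imat.span ?U)" if "(i, j) \<in> Q" for i j
      proof -
        have "slice a i j \<in> A" using a that unfolding block_matrices_def by (metis (mono_tags, lifting) mem_Collect_eq)
        moreover have "matrix_unit i j \<in> imat.span ?U" using that by (intro imat.span_base) blast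
        ultimately show ?thesis unfolding tensor_def emb_def by (intro imat.span_base) blast
      qed
      then show ?thesis
        using imat.subspace_sum[of "tensor A (imat.span ?U)" Q] unfolding tensor_def
        by (auto simp: imat.subspace_span)
    qed
    finally show "a \<in> tensor A (imat.span ?U)" .
  qed
qed

lemma ut_positions_subset: "ut_positions p \<subseteq> {1..sum_list p} \<times> {1..sum_list p}"
proof -
  have "sum_list (take k p) \<le> sum_list p" for k
    by (metis append_take_drop_id le_add1 sum_list_append)
  then show ?thesis
    unfolding ut_positions_def block_def by (fastforce intro: order_trans)
qed

lemma finite_ut_positions [simp]: "finite (ut_positions p)"
  using ut_positions_subset finite_subset by blast

lemma tensor_UT_algebra:
  "tensor (matrix_algebra t) (UT_algebra p)
    = block_matrices (\<lambda>k l. if (k, l) \<in> ut_positions p then matrix_algebra t else {0})"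
  unfolding UT_algebra_def by (rule tensor_span_matrix_units[OF subspace_matrix_algebra finite_ut_positions])

text \<open>A matrix unit at \<open>(k, l)\<close> has the fixed degree
  \<open>\<gamma> k - \<gamma> l\<close>, so among all splittings of \<open>g\<close> into two
  degrees only one reaches this block.\<close>

lemma tensor_elementary_grading:
  fixes \<Gamma> :: "'g::ab_group_add \<Rightarrow> ('i, 'k::field) imat set"
  assumes \<Gamma>: "\<And>g. imat.subspace (\<Gamma> g)"
  shows "tensor_grading \<Gamma> (elementary_grading p \<gamma>) g
    = block_matrices (\<lambda>k l. if (k, l) \<in> ut_positions p then \<Gamma> (g - (\<gamma> k - \<gamma> l)) else {0})"
proof
  let ?Q = "\<lambda>h. {(i, j). (i, j) \<in> ut_positions p \<and> \<gamma> i - \<gamma> j = h}"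
  let ?X = "\<lambda>k l. if (k, l) \<in> ut_positions p then \<Gamma> (g - (\<gamma> k - \<gamma> l)) else {0}"
  have *: "tensor (\<Gamma> h) (elementary_grading p \<gamma> h')
    = block_matrices (\<lambda>k l. if (k, l) \<in> ?Q h' then \<Gamma> h else {0})" for h h'
  proof -
    have "finite (?Q h')" by (rule finite_subset[OF _ finite_ut_positions]) auto
    from tensor_span_matrix_units[OF \<Gamma> this] show ?thesis
      unfolding elementary_grading_def by simp
  qed
  have sub: "imat.subspace (block_matrices ?X)"
    using \<Gamma> by (intro subspace_block_matrices) simp
  show "tensor_grading \<Gamma> (elementary_grading p \<gamma>) g \<subseteq> block_matrices ?X"
    unfolding tensor_grading_def
  proof (intro imat.span_minimal sub Union_least)
    fix Y assume "Y \<in> {tensor (\<Gamma> h) (elementary_grading p \<gamma> k) | h k. h + k = g}"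
    then obtain h k where Y: "h + k = g" "Y = tensor (\<Gamma> h) (elementary_grading p \<gamma> k)" by blast
    have "h = g - k" using Y(1) by (simp add: eq_diff_eq)
    then show "Y \<subseteq> block_matrices ?X"
      unfolding Y(2) * block_matrices_def using imat.subspace_0[OF \<Gamma>]
      by (fastforce split: if_splits)
  qed
  let ?Y = "\<Union>{tensor (\<Gamma> h) (elementary_grading p \<gamma> k) | h k. h + k = g}"
  show "block_matrices ?X \<subseteq> tensor_grading \<Gamma> (elementary_grading p \<gamma>) g"
  proof
    fix a assume a: "a \<in> block_matrices ?X"
    have "a = (\<Sum>(i, j)\<in>ut_positions p. emb i j (slice a i j))"
      using a by (intro sum_emb_slice[symmetric]) (simp_all add: block_matrices_def, metis singletonD)
    also have "\<dots> \<in> imat.span ?Y"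
    proof (rule imat.span_sum, clarify)
      fix i j assume ij: "(i, j) \<in> ut_positions p"
      have "slice a i j \<in> \<Gamma> (g - (\<gamma> i - \<gamma> j))"
        using a ij unfolding block_matrices_def by (metis (mono_tags, lifting) mem_Collect_eq)
      then have "emb i j (slice a i j) \<in> tensor (\<Gamma> (g - (\<gamma> i - \<gamma> j))) (elementary_grading p \<gamma> (\<gamma> i - \<gamma> j))"
        unfolding * block_matrices_def using ij imat.subspace_0[OF \<Gamma>] by (auto simp: slice_emb)
      moreover have "g - (\<gamma> i - \<gamma> j) + (\<gamma> i - \<gamma> j) = g" by simp
      ultimately show "emb i j (slice a i j) \<in> imat.span ?Y"
        by (intro imat.span_base) blast
    qed
    finally show "a \<in> tensor_grading \<Gamma> (elementary_grading p \<gamma>) g"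
      unfolding tensor_grading_def .
  qed
qed

subsection \<open>Decompositions of one into primitive idempotents\<close>

text \<open>Bijections between the fibres are glued together. With equivalence classes as fibres
  this gives a matching that respects equivalence.\<close>

lemma bij_betw_same_fibre_cards:
  assumes fin: "finite I" "finite J"
    and card: "\<And>L. card {i \<in> I. f i = L} = card {j \<in> J. g j = L}"
  obtains \<tau> where "bij_betw \<tau> I J" "\<And>i. i \<in> I \<Longrightarrow> g (\<tau> i) = f i"
proof -
  have "\<exists>h. bij_betw h {i \<in> I. f i = L} {j \<in> J. g j = L}" for L
    using fin card by (intro finite_same_card_bij) auto
  then obtain h where h: "\<And>L. bij_betw (h L) {i \<in> I. f i = L} {j \<in> J. g j = L}" by metis
  let ?\<tau> = "\<lambda>i. h (f i) i"
  have img: "?\<tau> i \<in> J \<and> g (?\<tau> i) = f i" if "i \<in> I" for i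
    using bij_betwE[OF h[of "f i"]] that by blast
  have "bij_betw ?\<tau> I J"
  proof (rule bij_betw_imageI)
    show "inj_on ?\<tau> I"
    proof (rule inj_onI)
      fix i i' assume *: "i \<in> I" "i' \<in> I" "?\<tau> i = ?\<tau> i'"
      then have "f i = f i'" using img by metis
      then show "i = i'" using bij_betw_imp_inj_on[OF h[of "f i"]] * by (auto dest: inj_onD)
    qed
    show "?\<tau> ` I = J"
    proof
      show "?\<tau> ` I \<subseteq> J" using img by blast
      show "J \<subseteq> ?\<tau> ` I"
      proof
        fix j assume "j \<in> J"
        then have "j \<in> h (g j) ` {i \<in> I. f i = g j}"
          using bij_betw_imp_surj_on[OF h[of "g j"]] by blast
        then show "j \<in> ?\<tau> ` I" by force
      qed
    qed
  qed
  then show thesis using that[of ?\<tau>] img by blast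
qed

locale fin_subalgebra =
  fixes R :: "('i, 'k::field) imat set"
  assumes fin: "R \<subseteq> fin_mats" and sub: "imat.subspace R"
    and closed: "\<And>a b. a \<in> R \<Longrightarrow> b \<in> R \<Longrightarrow> a \<odot> b \<in> R"
begin

text \<open>Stronger than primitivity in the usual sense: the corner \<open>e R e\<close> is
  one-dimensional, not merely free of further idempotents. This lets a scalar measure how two
  idempotents overlap.\<close>

definition primitive :: "('i, 'k) imat \<Rightarrow> bool" where
  "primitive e \<longleftrightarrow> e \<in> R \<and> e \<noteq> 0 \<and> e \<odot> e = e \<and> (\<forall>x\<in>R. \<exists>c. e \<odot> x \<odot> e = mat_scale c e)"

text \<open>Isomorphism of the right ideals \<open>e R\<close> and \<open>f R\<close>, witnessed by
  \<open>a\<close> in \<open>e R f\<close> and \<open>b\<close> in \<open>f R e\<close>. The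
  witnesses themselves matter later, as they transport corners.\<close>

definition equivalent :: "('i, 'k) imat \<Rightarrow> ('i, 'k) imat \<Rightarrow> bool" where
  "equivalent e f \<longleftrightarrow> (\<exists>a\<in>R. \<exists>b\<in>R. e \<odot> a = a \<and> a \<odot> f = a \<and> f \<odot> b = b \<and> b \<odot> e = b
     \<and> a \<odot> b = e \<and> b \<odot> a = f)"

lemma assoc: "a \<in> R \<Longrightarrow> b \<in> R \<Longrightarrow> c \<in> R \<Longrightarrow> a \<odot> b \<odot> c = a \<odot> (b \<odot> c)"
  using fin by (blast intro: mat_mult_assoc)

lemma equivalent_refl: "primitive e \<Longrightarrow> equivalent e e"
  unfolding primitive_def equivalent_def by blast

lemma equivalent_sym: "equivalent e f \<Longrightarrow> equivalent f e"
  unfolding equivalent_def by blast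

lemma equivalent_trans:
  assumes "equivalent e f" "equivalent f g"
  shows "equivalent e g"
proof -
  obtain a b where ab: "a \<in> R" "b \<in> R" "e \<odot> a = a" "a \<odot> f = a" "f \<odot> b = b" "b \<odot> e = b"
    "a \<odot> b = e" "b \<odot> a = f" using assms(1) unfolding equivalent_def by blast
  obtain c d where cd: "c \<in> R" "d \<in> R" "f \<odot> c = c" "c \<odot> g = c" "g \<odot> d = d" "d \<odot> f = d"
    "c \<odot> d = f" "d \<odot> c = g" using assms(2) unfolding equivalent_def by blast
  have R: "e \<in> R" "f \<in> R" "g \<in> R" using ab cd closed by blast+
  have "a \<odot> c \<odot> (d \<odot> b) = a \<odot> (c \<odot> d \<odot> b)" "d \<odot> b \<odot> (a \<odot> c) = d \<odot> (b \<odot> a \<odot> c)"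
    by (simp_all add: assoc ab(1,2) cd(1,2) R closed)
  moreover have "e \<odot> (a \<odot> c) = a \<odot> c" "a \<odot> c \<odot> g = a \<odot> c" "g \<odot> (d \<odot> b) = d \<odot> b" "d \<odot> b \<odot> e = d \<odot> b"
    using ab cd R by (metis assoc closed)+
  ultimately show ?thesis
    unfolding equivalent_def using ab cd closed by (intro bexI[of _ "a \<odot> c"] bexI[of _ "d \<odot> b"]) simp_all
qed

text \<open>Squaring \<open>e f e\<close> and regrouping around \<open>f e f\<close> gives
  \<open>c * c = d * c\<close> for the two corner scalars, and by symmetry
  \<open>d * d = c * d\<close>, so they coincide. If \<open>c\<close> is nonzero, \<open>e f\<close>
  divided by \<open>c\<close> and \<open>f e\<close> witness the equivalence.\<close>

lemma primitive_compare:
  assumes e: "primitive e" and f: "primitive f"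
  shows "\<exists>c. e \<odot> f \<odot> e = mat_scale c e \<and> f \<odot> e \<odot> f = mat_scale c f \<and> (c \<noteq> 0 \<longrightarrow> equivalent e f)"
proof -
  have R: "e \<in> R" "f \<in> R" and idem: "e \<odot> e = e" "f \<odot> f = f" and nz: "e \<noteq> 0" "f \<noteq> 0"
    using e f unfolding primitive_def by auto
  note fm = R[THEN subsetD[OF fin]]
  obtain c d where c: "e \<odot> f \<odot> e = mat_scale c e" and d: "f \<odot> e \<odot> f = mat_scale d f"
    using e f R unfolding primitive_def by blast
  have "mat_scale (c * c) e = (e \<odot> f \<odot> e) \<odot> (e \<odot> f \<odot> e)" by (simp add: c fm idem)
  also have "\<dots> = e \<odot> (f \<odot> (e \<odot> e) \<odot> f) \<odot> e" by (simp add: mat_mult_assoc fm)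
  also have "\<dots> = mat_scale (d * c) e" by (simp add: idem d c fm)
  finally have cc: "c * c = d * c" by (rule imat.scale_right_imp_eq[OF nz(1)])
  have "mat_scale (d * d) f = (f \<odot> e \<odot> f) \<odot> (f \<odot> e \<odot> f)" by (simp add: d fm idem)
  also have "\<dots> = f \<odot> (e \<odot> (f \<odot> f) \<odot> e) \<odot> f" by (simp add: mat_mult_assoc fm)
  also have "\<dots> = mat_scale (c * d) f" by (simp add: idem d c fm)
  finally have dd: "d * d = c * d" by (rule imat.scale_right_imp_eq[OF nz(2)])
  have cd: "c = d" using cc dd by auto
  have "equivalent e f" if "c \<noteq> 0"
  proof -
    let ?a = "mat_scale (inverse c) (e \<odot> f)" and ?b = "f \<odot> e"
    have "?a \<in> R" "?b \<in> R" using R closed imat.subspace_scale[OF sub] by auto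
    moreover have "e \<odot> ?a = ?a" "?a \<odot> f = ?a" "f \<odot> ?b = ?b" "?b \<odot> e = ?b"
      using R idem by (simp_all add: fm) (metis assoc)+
    moreover have "?a \<odot> ?b = mat_scale (inverse c) (e \<odot> (f \<odot> f) \<odot> e)"
      "?b \<odot> ?a = mat_scale (inverse c) (f \<odot> (e \<odot> e) \<odot> f)"
      by (simp_all add: fm mat_mult_assoc)
    ultimately show ?thesis using that unfolding equivalent_def
      by (intro bexI[of _ ?a] bexI[of _ ?b]) (simp_all add: idem c d flip: cd)
  qed
  then show ?thesis using c d cd by blast
qed

lemma primitive_decompositions:
  assumes char0: "\<And>m n. (of_nat m :: 'k) = of_nat n \<Longrightarrow> m = n"
    and fin_IJ: "finite I" "finite J"
    and f: "\<And>i. i \<in> I \<Longrightarrow> primitive (f i)" and e: "\<And>j. j \<in> J \<Longrightarrow> primitive (e j)"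
    and u: "\<And>x. x \<in> R \<Longrightarrow> (\<Sum>i\<in>I. f i) \<odot> x = x" and eq: "(\<Sum>i\<in>I. f i) = (\<Sum>j\<in>J. e j)"
  shows "\<exists>\<tau>. bij_betw \<tau> I J \<and> (\<forall>i\<in>I. equivalent (f i) (e (\<tau> i)))"
proof -
  \<comment> \<open>Equivalence classes serve as labels, so that matching within classes becomes
    matching of fibres of a function.\<close>
  define lab where "lab x = {y. equivalent x y}" for x
  have lab_eq: "lab x = lab y \<longleftrightarrow> equivalent x y" if "primitive y" for x y
    unfolding lab_def using equivalent_refl[OF that] equivalent_sym equivalent_trans by blast
  have "\<forall>i j. \<exists>c. i \<in> I \<longrightarrow> j \<in> J \<longrightarrow> f i \<odot> e j \<odot> f i = mat_scale c (f i) \<and>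
      e j \<odot> f i \<odot> e j = mat_scale c (e j) \<and> (c \<noteq> 0 \<longrightarrow> equivalent (f i) (e j))"
    using primitive_compare f e by blast
  then obtain c where c: "\<And>i j. i \<in> I \<Longrightarrow> j \<in> J \<Longrightarrow> f i \<odot> e j \<odot> f i = mat_scale (c i j) (f i)"
    "\<And>i j. i \<in> I \<Longrightarrow> j \<in> J \<Longrightarrow> e j \<odot> f i \<odot> e j = mat_scale (c i j) (e j)"
    "\<And>i j. i \<in> I \<Longrightarrow> j \<in> J \<Longrightarrow> c i j \<noteq> 0 \<Longrightarrow> equivalent (f i) (e j)"
    by metis
  \<comment> \<open>The \<open>h y\<close> add up to a left unit, so the \<open>d y\<close> add up
    to the coefficient of \<open>x x = x\<close>. One argument serves the rows
    (\<open>x = f i\<close>) and the columns (\<open>x = e j\<close>).\<close>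
  have total: "(\<Sum>y\<in>Y. d y) = 1"
    if x: "primitive x" and Y: "\<And>y. y \<in> Y \<Longrightarrow> h y \<in> R" "\<And>x. x \<in> R \<Longrightarrow> (\<Sum>y\<in>Y. h y) \<odot> x = x"
      and d: "\<And>y. y \<in> Y \<Longrightarrow> x \<odot> h y \<odot> x = mat_scale (d y) x" for x d and Y :: "'z set" and h
  proof -
    have xR: "x \<in> R" and x0: "x \<noteq> 0" "x \<odot> x = x" using x unfolding primitive_def by auto
    note fm = subsetD[OF fin xR] subsetD[OF fin Y(1)]
    have "mat_scale (\<Sum>y\<in>Y. d y) x = (\<Sum>y\<in>Y. x \<odot> h y \<odot> x)"
      by (simp add: d imat.scale_sum_left)
    also have "\<dots> = x \<odot> (\<Sum>y\<in>Y. h y) \<odot> x"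
      using fm by (simp add: mat_mult_sum_left mat_mult_sum_right)
    also have "\<dots> = x \<odot> ((\<Sum>y\<in>Y. h y) \<odot> x)"
      using fm by (intro mat_mult_assoc) auto
    also have "\<dots> = mat_scale 1 x" using Y(2)[OF xR] x0 by simp
    finally show ?thesis using x0 by (simp only: imat.scale_cancel_right) simp
  qed
  have row: "(\<Sum>j\<in>J. c i j) = 1" if "i \<in> I" for i
    by (rule total[OF f[OF that], of J e]) (use e u eq c that primitive_def in auto)
  have col: "(\<Sum>i\<in>I. c i j) = 1" if "j \<in> J" for j
    by (rule total[OF e[OF that], of I f]) (use f u c that primitive_def in auto)
  have "card {i \<in> I. lab (f i) = L} = card {j \<in> J. lab (e j) = L}" for L
  proof (rule char0)
    let ?I = "{i \<in> I. lab (f i) = L}" and ?J = "{j \<in> J. lab (e j) = L}"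
    have same: "lab (f i) = lab (e j)" if "i \<in> I" "j \<in> J" "c i j \<noteq> 0" for i j
      using lab_eq[OF e] c(3) that by blast
    \<comment> \<open>Row sums count \<open>?I\<close>; as entries leaving the class vanish, the
      same total is a sum over full columns and counts \<open>?J\<close>.\<close>
    have "(of_nat (card ?I) :: 'k) = (\<Sum>i\<in>?I. \<Sum>j\<in>J. c i j)" using row by simp
    also have "\<dots> = (\<Sum>i\<in>?I. \<Sum>j\<in>?J. c i j)"
      using fin_IJ same by (intro sum.cong refl sum.mono_neutral_right) auto
    also have "\<dots> = (\<Sum>j\<in>?J. \<Sum>i\<in>?I. c i j)" by (rule sum.swap)
    also have "\<dots> = (\<Sum>j\<in>?J. \<Sum>i\<in>I. c i j)"
      using fin_IJ same by (intro sum.cong refl sum.mono_neutral_left) auto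
    also have "\<dots> = of_nat (card ?J)" using col by simp
    finally show "(of_nat (card ?I) :: 'k) = of_nat (card ?J)" .
  qed
  then obtain \<tau> where "bij_betw \<tau> I J" "\<And>i. i \<in> I \<Longrightarrow> lab (e (\<tau> i)) = lab (f i)"
    using bij_betw_same_fibre_cards[OF fin_IJ, of "\<lambda>i. lab (f i)" "\<lambda>j. lab (e j)"] by blast
  then show ?thesis using lab_eq[OF e] bij_betwE by metis
qed

end

subsection \<open>Positions of upper block triangular matrices\<close>

lemma sum_list_take_mono: "k \<le> l \<Longrightarrow> sum_list (take k p) \<le> sum_list (take l (p :: nat list))"
proof -
  assume "k \<le> l"
  then obtain d where "l = k + d" using le_Suc_ex by blast
  then show ?thesis by (simp add: take_add)
qed

lemma sum_list_take_le: "sum_list (take k p) \<le> sum_list (p :: nat list)"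
  using sum_list_take_mono[of k "max k (length p)" p] by simp

lemma block_less:
  assumes "i \<in> block p k" "j \<in> block p l" "k < l"
  shows "i < j"
proof -
  have "sum_list (take k p) \<le> sum_list (take (l - 1) p)"
    using assms(3) by (intro sum_list_take_mono) simp
  then show ?thesis using assms(1,2) unfolding block_def atLeastAtMost_iff by linarith
qed

lemma block_unique: "i \<in> block p k \<Longrightarrow> i \<in> block p l \<Longrightarrow> k = l"
  using block_less[of i p k i l] block_less[of i p l i k] by (metis less_irrefl linorder_neqE_nat)

lemma block_exists:
  assumes "i \<in> {1..sum_list p}"
  obtains k where "k \<in> {1..length p}" "i \<in> block p k"
proof -
  define k where "k = (LEAST k. i \<le> sum_list (take k p))"
  have ex: "i \<le> sum_list (take (length p) p)" using assms by simp
  have k: "i \<le> sum_list (take k p)" unfolding k_def by (rule LeastI[of _ "length p"], rule ex)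
  have "k \<le> length p" unfolding k_def by (rule Least_le, rule ex)
  moreover have "k \<noteq> 0" using k assms by (intro notI) simp
  moreover have "\<not> i \<le> sum_list (take (k - 1) p)"
    using not_less_Least[of "k - 1" "\<lambda>k. i \<le> sum_list (take k p)"] \<open>k \<noteq> 0\<close> unfolding k_def by simp
  ultimately show thesis using that[of k] k by (auto simp: block_def)
qed

text \<open>Row \<open>i\<close> is a final segment of the columns, beginning where the block of
  \<open>i\<close> begins. Hence the length of a row reveals the start of its block.\<close>

lemma ut_positions_iff:
  assumes "k \<in> {1..length p}" "i \<in> block p k"
  shows "(i, j) \<in> ut_positions p \<longleftrightarrow> sum_list (take (k - 1) p) < j \<and> j \<le> sum_list p"
proof
  assume "(i, j) \<in> ut_positions p"
  then obtain k' l where kl: "1 \<le> k'" "k' \<le> l" "l \<le> length p" "i \<in> block p k'" "j \<in> block p l"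
    by (auto simp: ut_positions_def)
  then have "k' = k" using assms block_unique by blast
  have "sum_list (take (k - 1) p) \<le> sum_list (take (l - 1) p)"
    using kl(2) \<open>k' = k\<close> by (intro sum_list_take_mono) simp
  then show "sum_list (take (k - 1) p) < j \<and> j \<le> sum_list p"
    using kl(5) sum_list_take_le[of l p] unfolding block_def atLeastAtMost_iff by linarith
next
  assume j: "sum_list (take (k - 1) p) < j \<and> j \<le> sum_list p"
  then obtain l where l: "l \<in> {1..length p}" "j \<in> block p l"
    using block_exists[of j p] by (auto simp: Suc_le_eq)
  have "k \<le> l"
  proof (rule ccontr)
    assume "\<not> k \<le> l"
    then have "l \<le> k - 1" by simp
    then have "sum_list (take l p) \<le> sum_list (take (k - 1) p)"
      by (rule sum_list_take_mono)
    then show False using j l by (auto simp: block_def)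
  qed
  then show "(i, j) \<in> ut_positions p"
    using assms l by (auto simp: ut_positions_def)
qed

lemma ut_positions_refl: "i \<in> {1..sum_list p} \<Longrightarrow> (i, i) \<in> ut_positions p"
  by (rule block_exists[of i p]) (auto simp: ut_positions_def)

lemma ut_positions_trans: "(i, j) \<in> ut_positions p \<Longrightarrow> (j, k) \<in> ut_positions p \<Longrightarrow> (i, k) \<in> ut_positions p"
  by (clarsimp simp: ut_positions_def) (metis block_unique order_trans)

lemma ut_positions_first: "j \<in> {1..sum_list p} \<Longrightarrow> (1, j) \<in> ut_positions p"
proof -
  assume j: "j \<in> {1..sum_list p}"
  then have "1 \<in> {1..sum_list p}" by simp
  then obtain k where k: "k \<in> {1..length p}" "1 \<in> block p k" by (rule block_exists)
  \<comment> \<open>\<open>k\<close> may exceed 1, as empty blocks can precede the one containing 1;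
    their sizes add up to 0.\<close>
  then have "sum_list (take (k - 1) p) = 0"
    unfolding block_def atLeastAtMost_iff by linarith
  then show ?thesis using j unfolding ut_positions_iff[OF k] atLeastAtMost_iff by linarith
qed

lemma card_ut_row:
  assumes "k \<in> {1..length p}" "i \<in> block p k"
  shows "card {j. (i, j) \<in> ut_positions p} = sum_list p - sum_list (take (k - 1) p)"
proof -
  have "{j. (i, j) \<in> ut_positions p} = {sum_list (take (k - 1) p)<..sum_list p}"
    unfolding ut_positions_iff[OF assms] by (rule set_eqI) simp
  then show ?thesis by simp
qed

lemma sum_list_take_strict_mono:
  assumes "\<forall>x\<in>set p. x \<ge> (1::nat)" "k < l" "l \<le> length p"
  shows "sum_list (take k p) < sum_list (take l p)"
proof -
  have "sum_list (take k p) < sum_list (take (Suc k) p)"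
    using assms nth_mem[of k p] by (auto simp: take_Suc_conv_app_nth Suc_le_eq)
  also have "\<dots> \<le> sum_list (take l p)"
    using assms(2) by (intro sum_list_take_mono) simp
  finally show ?thesis .
qed

text \<open>The block sizes are recovered from the row lengths of \<^const>\<open>ut_positions\<close>.\<close>

lemma ut_positions_bij_blocks:
  assumes pos: "\<forall>x\<in>set p. x \<ge> 1" "\<forall>x\<in>set p'. x \<ge> 1"
    and bij: "bij_betw \<tau> {1..sum_list p} {1..sum_list p'}"
    and ut: "\<And>i j. i \<in> {1..sum_list p} \<Longrightarrow> j \<in> {1..sum_list p} \<Longrightarrow>
      (\<tau> i, \<tau> j) \<in> ut_positions p' \<longleftrightarrow> (i, j) \<in> ut_positions p"
  shows "p = p'" and "\<And>i k. i \<in> block p k \<Longrightarrow> k \<in> {1..length p} \<Longrightarrow> \<tau> i \<in> block p k"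
proof -
  let ?n = "sum_list p"
  have n: "?n = sum_list p'" using bij_betw_same_card[OF bij] by simp
  have row: "card {j. (\<tau> i, j) \<in> ut_positions p'} = card {j. (i, j) \<in> ut_positions p}"
    if i: "i \<in> {1..?n}" for i
  proof -
    have "bij_betw \<tau> {j. (i, j) \<in> ut_positions p} {j. (\<tau> i, j) \<in> ut_positions p'}"
      unfolding bij_betw_def
    proof
      show "inj_on \<tau> {j. (i, j) \<in> ut_positions p}"
        using bij ut_positions_subset[of p] unfolding bij_betw_def
        by (blast intro: inj_on_subset)
      show "\<tau> ` {j. (i, j) \<in> ut_positions p} = {j. (\<tau> i, j) \<in> ut_positions p'}"
      proof safe
        fix j assume "(i, j) \<in> ut_positions p"
        then show "(\<tau> i, \<tau> j) \<in> ut_positions p'" using ut[OF i] ut_positions_subset[of p] by blast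
      next
        fix j assume j: "(\<tau> i, j) \<in> ut_positions p'"
        then have "j \<in> \<tau> ` {1..?n}"
          using bij ut_positions_subset[of p'] unfolding bij_betw_def by blast
        then obtain j' where "j' \<in> {1..?n}" "j = \<tau> j'" by blast
        then show "j \<in> \<tau> ` {j. (i, j) \<in> ut_positions p}" using ut[OF i] j by auto
      qed
    qed
    then show ?thesis by (simp add: bij_betw_same_card)
  qed
  \<comment> \<open>Equal row lengths and equal totals force the blocks of \<open>i\<close> and
    \<open>\<tau> i\<close> to begin at the same place, although their block indices are not yet
    known to agree.\<close>
  have same: "sum_list (take (l - 1) p') = sum_list (take (k - 1) p)"
    if "k \<in> {1..length p}" "i \<in> block p k" "l \<in> {1..length p'}" "\<tau> i \<in> block p' l" for i k l
  proof -
    have "i \<in> {1..?n}" using that(1,2) sum_list_take_le[of k p] by (auto simp: block_def)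
    from row[OF this] show ?thesis
      using card_ut_row[OF that(1,2)] card_ut_row[OF that(3,4)] n
        sum_list_take_le[of "l - 1" p'] sum_list_take_le[of "k - 1" p] by linarith
  qed
  \<comment> \<open>Positivity makes every block nonempty, so every block start is witnessed by some
    row.\<close>
  have fill: "\<exists>i. i \<in> block q k" if "\<forall>x\<in>set q. x \<ge> 1" "k \<in> {1..length q}" for q k
    using sum_list_take_strict_mono[OF that(1), of "k - 1" k] that(2)
    by (intro exI[of _ "sum_list (take k q)"]) (auto simp: block_def)
  \<comment> \<open>All partial sums: the block starts, which the rows reveal, together with the
    total, at which no block starts.\<close>
  let ?S = "\<lambda>q. (\<lambda>k. sum_list (take k q)) ` {..length q}"
  have S: "?S q = insert (sum_list q) ((\<lambda>k. sum_list (take (k - 1) q)) ` {1..length q})" for q :: "nat list"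
  proof -
    have "{..length q} = insert (length q) ((\<lambda>k. k - 1) ` {1..length q})"
    proof (intro equalityI subsetI)
      fix k assume "k \<in> {..length q}"
      then show "k \<in> insert (length q) ((\<lambda>k. k - 1) ` {1..length q})"
        by (cases "k = length q") (auto intro!: image_eqI[of _ _ "Suc k"])
    qed auto
    then show ?thesis by (simp add: image_image)
  qed
  have eqS: "?S p = ?S p'"
  proof -
    have "\<exists>l\<in>{1..length p'}. sum_list (take (l - 1) p') = sum_list (take (k - 1) p)" if k: "k \<in> {1..length p}" for k
    proof -
      obtain i where i: "i \<in> block p k" using fill[OF pos(1) k] by blast
      then have "i \<in> {1..?n}" using sum_list_take_le[of k p] by (auto simp: block_def)
      then have "\<tau> i \<in> {1..sum_list p'}" using bij by (auto simp: bij_betw_def)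
      then obtain l where l: "l \<in> {1..length p'}" "\<tau> i \<in> block p' l" by (rule block_exists)
      from same[OF k i l] l(1) show ?thesis by blast
    qed
    moreover have "\<exists>k\<in>{1..length p}. sum_list (take (l - 1) p') = sum_list (take (k - 1) p)" if l: "l \<in> {1..length p'}" for l
    proof -
      obtain j where j: "j \<in> block p' l" using fill[OF pos(2) l] by blast
      then have "j \<in> {1..sum_list p'}" using sum_list_take_le[of l p'] by (auto simp: block_def)
      then have "j \<in> \<tau> ` {1..?n}" unfolding bij_betw_imp_surj_on[OF bij] .
      then obtain i where i: "i \<in> {1..?n}" "\<tau> i = j" by (elim imageE) simp
      from i(1) obtain k where k: "k \<in> {1..length p}" "i \<in> block p k" by (rule block_exists)
      have "\<tau> i \<in> block p' l" using i(2) j by simp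
      from same[OF k l this] k(1) show ?thesis by (rule bexI)
    qed
    ultimately have "(\<lambda>k. sum_list (take (k - 1) p)) ` {1..length p}
        = (\<lambda>l. sum_list (take (l - 1) p')) ` {1..length p'}"
      unfolding set_eq_iff image_iff by metis
    then show ?thesis unfolding S n by (rule arg_cong)
  qed
  \<comment> \<open>Positive sizes make the partial sums strictly increasing, so the list is
    determined by its set. Its length gives the number of blocks, its differences give their
    sizes.\<close>
  let ?L = "\<lambda>q. map (\<lambda>k. sum_list (take k q)) [0..<Suc (length q)]"
  have "sorted_wrt (<) (?L q)" if "\<forall>x\<in>set q. x \<ge> 1" for q :: "nat list"
    using sum_list_take_strict_mono[OF that] by (auto simp: sorted_wrt_iff_nth_less simp del: upt_Suc)
  moreover have "set (?L q) = ?S q" for q by (simp add: atLeast0LessThan lessThan_Suc_atMost del: upt_Suc)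
  ultimately have L: "?L p = ?L p'" using eqS pos strict_sorted_equal by metis
  then have len: "length p = length p'" by (metis length_map length_upt diff_zero nat.inject)
  have tk: "sum_list (take k p) = sum_list (take k p')" if "k \<le> length p" for k
    using arg_cong[OF L, of "\<lambda>xs. xs ! k"] that len by (simp del: upt_Suc)
  show pp: "p = p'"
  proof (rule nth_equalityI[OF len])
    fix k assume "k < length p"
    then show "p ! k = p' ! k" using tk[of k] tk[of "Suc k"] len by (simp add: take_Suc_conv_app_nth)
  qed
  fix i k assume ik: "i \<in> block p k" "k \<in> {1..length p}"
  then have "i \<in> {1..?n}" using sum_list_take_le[of k p] by (auto simp: block_def)
  then have "\<tau> i \<in> {1..sum_list p}" using bij pp by (auto simp: bij_betw_def)
  then obtain l where l: "l \<in> {1..length p}" "\<tau> i \<in> block p l" by (rule block_exists)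
  have "sum_list (take (l - 1) p) = sum_list (take (k - 1) p)"
    using same[OF ik(2,1), of l] l unfolding pp[symmetric] by blast
  moreover have "l - 1 \<le> length p" "k - 1 \<le> length p"
    using l(1) ik(2) unfolding atLeastAtMost_iff by linarith+
  ultimately have "l - 1 = k - 1"
    using sum_list_take_strict_mono[OF pos(1), of "l - 1" "k - 1"]
      sum_list_take_strict_mono[OF pos(1), of "k - 1" "l - 1"]
    by (metis less_irrefl linorder_neqE_nat)
  \<comment> \<open>Both indices are at least 1, so their truncated predecessors determine
    them.\<close>
  then have "l = k" using l ik by auto
  then show "\<tau> i \<in> block p k" using l by simp
qed

lemma ut_positions_block_iff:
  assumes k: "k \<in> {1..length p}" "i \<in> block p k" and l: "l \<in> {1..length p}" "j \<in> block p l"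
  shows "(i, j) \<in> ut_positions p \<longleftrightarrow> k \<le> l"
proof
  assume "(i, j) \<in> ut_positions p"
  then obtain k' l' where "k' \<le> l'" "i \<in> block p k'" "j \<in> block p l'" unfolding ut_positions_def by blast
  then show "k \<le> l" using block_unique k(2) l(2) by metis
next
  assume "k \<le> l"
  then show "(i, j) \<in> ut_positions p" using k l unfolding ut_positions_def by auto
qed

lemma block_subset: "block p k \<subseteq> {1..sum_list p}"
proof
  fix i assume "i \<in> block p k"
  then show "i \<in> {1..sum_list p}"
    using sum_list_take_le[of k p] unfolding block_def atLeastAtMost_iff by linarith
qed

lemma ut_positions_image_iff:
  assumes \<sigma>: "\<sigma> permutes {1..sum_list p}" and blocks: "\<forall>k\<in>{1..length p}. \<sigma> ` block p k = block p k"
  shows "(\<sigma> i, \<sigma> j) \<in> ut_positions p \<longleftrightarrow> (i, j) \<in> ut_positions p"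
proof (cases "i \<in> {1..sum_list p} \<and> j \<in> {1..sum_list p}")
  case True
  obtain k where k: "k \<in> {1..length p}" "i \<in> block p k" using True by (elim conjE block_exists)
  obtain l where l: "l \<in> {1..length p}" "j \<in> block p l" using True by (elim conjE block_exists)
  from k l have "\<sigma> i \<in> block p k" "\<sigma> j \<in> block p l" using blocks by blast+
  then show ?thesis using ut_positions_block_iff[OF k l] ut_positions_block_iff[OF k(1) _ l(1)] by simp
next
  case False
  then have "\<not> (\<sigma> i \<in> {1..sum_list p} \<and> \<sigma> j \<in> {1..sum_list p})"
    using permutes_in_image[OF \<sigma>] by blast
  with False show ?thesis using ut_positions_subset[of p] by blast
qed

subsection \<open>Gradings on block matrices\<close>

lemma mem_if_zero: "0 \<in> X \<Longrightarrow> x \<in> (if P then X else {0}) \<longleftrightarrow> x \<in> X \<and> (\<not> P \<longrightarrow> x = 0)"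
  by auto

lemma zero_matrix_algebra [simp]: "0 \<in> matrix_algebra t"
  by (simp add: matrix_algebra_def)

locale block_grading = fine_matrix_grading t \<Gamma>
  for t :: nat and \<Gamma> :: "'g::{finite, ab_group_add} \<Rightarrow> (nat, 'k::field) imat set" +
  fixes p :: "nat list" and \<gamma> :: "nat \<Rightarrow> 'g"
begin

definition alg :: "(nat \<times> nat, 'k) imat set" where
  "alg = block_matrices (\<lambda>k l. if (k, l) \<in> ut_positions p then matrix_algebra t else {0})"

definition comp :: "'g \<Rightarrow> (nat \<times> nat, 'k) imat set" where
  "comp g = block_matrices (\<lambda>k l. if (k, l) \<in> ut_positions p then \<Gamma> (g - (\<gamma> k - \<gamma> l)) else {0})"

definition idem :: "nat \<Rightarrow> (nat \<times> nat, 'k) imat" where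
  "idem i = emb i i (one_mat t)"

lemma tensor_eq_alg: "tensor (matrix_algebra t) (UT_algebra p) = alg"
  unfolding alg_def by (rule tensor_UT_algebra)

lemma tensor_grading_eq_comp: "tensor_grading \<Gamma> (elementary_grading p \<gamma>) = comp"
  unfolding comp_def by (rule ext, rule tensor_elementary_grading[OF subspace_component])

lemma alg_iff: "a \<in> alg \<longleftrightarrow>
  (\<forall>k l. slice a k l \<in> matrix_algebra t \<and> ((k, l) \<notin> ut_positions p \<longrightarrow> slice a k l = 0))"
  unfolding alg_def block_matrices_def by (simp add: mem_if_zero[OF zero_matrix_algebra])

lemma comp_iff: "a \<in> comp g \<longleftrightarrow>
  (\<forall>k l. slice a k l \<in> \<Gamma> (g - (\<gamma> k - \<gamma> l)) \<and> ((k, l) \<notin> ut_positions p \<longrightarrow> slice a k l = 0))"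
  unfolding comp_def block_matrices_def by (simp add: mem_if_zero[OF component_zero])

lemma comp_alg: "a \<in> comp g \<Longrightarrow> a \<in> alg"
  unfolding comp_iff alg_iff using component_matrix_algebra by blast

lemma subspace_alg: "imat.subspace alg"
  unfolding alg_def by (rule subspace_block_matrices) (simp add: subspace_matrix_algebra)

lemma subspace_comp: "imat.subspace (comp g)"
  unfolding comp_def by (rule subspace_block_matrices) (simp add: subspace_component)

lemma slice_outside: "a \<in> alg \<Longrightarrow> k \<notin> {1..sum_list p} \<or> l \<notin> {1..sum_list p} \<Longrightarrow> slice a k l = 0"
  using ut_positions_subset[of p] unfolding alg_iff by blast

lemma alg_fin_mats: "a \<in> alg \<Longrightarrow> a \<in> fin_mats"
proof -
  assume a: "a \<in> alg"
  have "a x y = 0" if "x \<notin> {1..t} \<times> {1..sum_list p} \<or> y \<notin> {1..t} \<times> {1..sum_list p}" for x y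
  proof -
    obtain i k j l where xy: "x = (i, k)" "y = (j, l)" by fastforce
    have "slice a k l i j = 0"
      using that slice_outside[OF a, of k l] matrix_algebra_zero[of "slice a k l" t i j] a
      unfolding xy alg_iff by (auto simp del: atLeastAtMost_iff)
    then show ?thesis by (simp add: slice_def xy)
  qed
  then show ?thesis
    unfolding fin_mats_def mem_Collect_eq by (intro exI[of _ "{1..t} \<times> {1..sum_list p}"]) blast
qed

lemma slice_mult_alg:
  "a \<in> alg \<Longrightarrow> slice (a \<odot> b) k l = (\<Sum>m\<in>{1..sum_list p}. slice a k m \<odot> slice b m l)"
  by (rule slice_mult) (auto simp: alg_fin_mats slice_outside simp del: atLeastAtMost_iff)

lemma slice_mult_outside:
  assumes "a \<in> alg" "b \<in> alg" "(k, l) \<notin> ut_positions p"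
  shows "slice (a \<odot> b) k l = 0"
proof -
  have "slice a k m \<odot> slice b m l = 0" for m
  proof -
    have "slice a k m = 0 \<or> slice b m l = 0"
      using assms ut_positions_trans[of k m p l] unfolding alg_iff by blast
    then show ?thesis by auto
  qed
  then show ?thesis by (simp add: slice_mult_alg assms(1))
qed

lemma alg_mult: "a \<in> alg \<Longrightarrow> b \<in> alg \<Longrightarrow> a \<odot> b \<in> alg"
  unfolding alg_iff[of "a \<odot> b"]
  by (auto simp: slice_mult_outside, auto simp: slice_mult_alg alg_iff
      intro!: imat.subspace_sum[OF subspace_matrix_algebra] matrix_algebra_mult)

lemma comp_mult:
  assumes a: "a \<in> comp g" and b: "b \<in> comp h"
  shows "a \<odot> b \<in> comp (g + h)"
proof -
  \<comment> \<open>The contributions of the intermediate index \<open>\<gamma> m\<close>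
    cancel.\<close>
  have "slice a k m \<odot> slice b m l \<in> \<Gamma> (g + h - (\<gamma> k - \<gamma> l))" for k l m
  proof -
    have "slice a k m \<odot> slice b m l \<in> \<Gamma> ((g - (\<gamma> k - \<gamma> m)) + (h - (\<gamma> m - \<gamma> l)))"
      using a b unfolding comp_iff by (intro component_mult) blast+
    then show ?thesis by (simp add: algebra_simps)
  qed
  then show ?thesis
    using comp_alg a b unfolding comp_iff[of "a \<odot> b"]
    by (auto simp: slice_mult_outside) (auto simp: slice_mult_alg intro!: imat.subspace_sum[OF subspace_component])
qed

lemma emb_alg: "(i, j) \<in> ut_positions p \<Longrightarrow> x \<in> matrix_algebra t \<Longrightarrow> emb i j x \<in> alg"
  unfolding alg_iff by (simp add: slice_emb)

lemma emb_comp: "(i, j) \<in> ut_positions p \<Longrightarrow> x \<in> \<Gamma> (g - (\<gamma> i - \<gamma> j)) \<Longrightarrow> emb i j x \<in> comp g"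
  unfolding comp_iff using component_zero by (simp add: slice_emb)

lemma emb_mult:
  assumes "x \<in> matrix_algebra t" "y \<in> matrix_algebra t"
  shows "emb i j x \<odot> emb j k y = emb i k (x \<odot> y)"
proof -
  have "emb i j x \<in> fin_mats"
  proof -
    have "emb i j x a b = 0" if "a \<notin> {1..t} \<times> {i, j} \<or> b \<notin> {1..t} \<times> {i, j}" for a b
      using that matrix_algebra_zero[OF assms(1), of "fst a" "fst b"]
      by (cases a; cases b) (auto simp: emb_def kron_def matrix_unit_def simp del: atLeastAtMost_iff)
    then show ?thesis
      unfolding fin_mats_def mem_Collect_eq by (intro exI[of _ "{1..t} \<times> {i, j}"]) blast
  qed
  then have "slice (emb i j x \<odot> emb j k y) r s = (\<Sum>m\<in>{j}. slice (emb i j x) r m \<odot> slice (emb j k y) m s)" for r s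
    by (rule slice_mult) (auto simp: slice_emb)
  then show ?thesis by (intro slice_eqI) (simp add: slice_emb)
qed

lemma idem_comp: "i \<in> {1..sum_list p} \<Longrightarrow> idem i \<in> comp 0"
  unfolding idem_def by (rule emb_comp) (simp_all add: ut_positions_refl one_mat_component)

lemma idem_alg: "i \<in> {1..sum_list p} \<Longrightarrow> idem i \<in> alg"
  using idem_comp comp_alg by blast

lemma slice_idem_mult:
  assumes "i \<in> {1..sum_list p}" "a \<in> alg"
  shows "slice (idem i \<odot> a) k l = (if k = i then slice a k l else 0)"
proof -
  have *: "slice a m l \<in> matrix_algebra t" for m using assms(2) unfolding alg_iff by blast
  have "slice (idem i \<odot> a) k l = (\<Sum>m\<in>{1..sum_list p}. if m = i then (if k = i then slice a k l else 0) else 0)"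
    unfolding slice_mult_alg[OF idem_alg[OF assms(1)]] unfolding idem_def
    by (intro sum.cong) (auto simp: slice_emb *)
  also have "\<dots> = (if k = i then slice a k l else 0)"
    unfolding sum.delta[OF finite_atLeastAtMost] by (simp only: assms(1) if_True)
  finally show ?thesis .
qed

lemma slice_mult_idem:
  assumes "j \<in> {1..sum_list p}" "a \<in> alg"
  shows "slice (a \<odot> idem j) k l = (if l = j then slice a k l else 0)"
proof -
  have *: "slice a k m \<in> matrix_algebra t" for m using assms(2) unfolding alg_iff by blast
  have "slice (a \<odot> idem j) k l = (\<Sum>m\<in>{1..sum_list p}. if m = j then (if l = j then slice a k l else 0) else 0)"
    unfolding slice_mult_alg[OF assms(2)] unfolding idem_def
    by (intro sum.cong) (auto simp: slice_emb *)
  also have "\<dots> = (if l = j then slice a k l else 0)"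
    unfolding sum.delta[OF finite_atLeastAtMost] by (simp only: assms(1) if_True)
  finally show ?thesis .
qed

text \<open>Blocks expressed through idempotents, as Peirce corners. In this form they can be
  followed through an isomorphism, which knows nothing of matrix positions.\<close>

lemma idem_sandwich:
  assumes "i \<in> {1..sum_list p}" "j \<in> {1..sum_list p}" "a \<in> alg"
  shows "idem i \<odot> a \<odot> idem j = emb i j (slice a i j)"
proof (rule slice_eqI)
  fix k l
  have "idem i \<odot> a \<in> alg" using assms alg_mult idem_alg by blast
  then show "slice (idem i \<odot> a \<odot> idem j) k l = slice (emb i j (slice a i j)) k l"
    by (simp add: slice_mult_idem[OF assms(2)] slice_idem_mult[OF assms(1,3)] slice_emb)
qed

lemma idem_emb:
  assumes "i \<in> {1..sum_list p}" "j \<in> {1..sum_list p}" "emb i j x \<in> alg"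
  shows "idem i \<odot> emb i j x \<odot> idem j = emb i j x"
  using idem_sandwich[OF assms] by simp

lemma sum_idem_mult:
  assumes "a \<in> alg"
  shows "(\<Sum>i\<in>{1..sum_list p}. idem i) \<odot> a = a" "a \<odot> (\<Sum>i\<in>{1..sum_list p}. idem i) = a"
proof -
  have fm: "a \<in> fin_mats" "\<And>i. i \<in> {1..sum_list p} \<Longrightarrow> idem i \<in> fin_mats"
    using assms alg_fin_mats idem_alg by blast+
  have left: "(\<Sum>i\<in>{1..sum_list p}. idem i) \<odot> a = (\<Sum>i\<in>{1..sum_list p}. idem i \<odot> a)"
    by (rule mat_mult_sum_left) (use fm in blast)+
  have right: "a \<odot> (\<Sum>i\<in>{1..sum_list p}. idem i) = (\<Sum>i\<in>{1..sum_list p}. a \<odot> idem i)"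
    by (rule mat_mult_sum_right) (use fm in blast)+
  have "slice ((\<Sum>i\<in>{1..sum_list p}. idem i) \<odot> a) k l = slice a k l" for k l
  proof -
    have "slice ((\<Sum>i\<in>{1..sum_list p}. idem i) \<odot> a) k l
        = (\<Sum>i\<in>{1..sum_list p}. if i = k then slice a k l else 0)"
      unfolding left slice_sum by (intro sum.cong refl) (simp only: slice_idem_mult[OF _ assms] eq_commute)
    then show ?thesis
      using slice_outside[OF assms, of k l] by (simp del: atLeastAtMost_iff)
  qed
  then show "(\<Sum>i\<in>{1..sum_list p}. idem i) \<odot> a = a" by (rule slice_eqI)
  have "slice (a \<odot> (\<Sum>i\<in>{1..sum_list p}. idem i)) k l = slice a k l" for k l
  proof -
    have "slice (a \<odot> (\<Sum>i\<in>{1..sum_list p}. idem i)) k l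
        = (\<Sum>i\<in>{1..sum_list p}. if i = l then slice a k l else 0)"
      unfolding right slice_sum by (intro sum.cong refl) (simp only: slice_mult_idem[OF _ assms] eq_commute)
    then show ?thesis
      using slice_outside[OF assms, of k l] by (simp del: atLeastAtMost_iff)
  qed
  then show "a \<odot> (\<Sum>i\<in>{1..sum_list p}. idem i) = a" by (rule slice_eqI)
qed

lemma sum_idem_comp: "(\<Sum>i\<in>{1..sum_list p}. idem i) \<in> comp 0"
  by (intro imat.subspace_sum[OF subspace_comp] idem_comp)

text \<open>The matching of idempotents takes place inside degree 0, so that the witnesses of
  equivalence preserve degrees when multiplied in.\<close>

sublocale degree_0: fin_subalgebra "comp 0"
  using comp_alg alg_fin_mats subspace_comp comp_mult[of _ 0 _ 0]
  by unfold_locales auto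

text \<open>On the diagonal the shift \<open>\<gamma> i - \<gamma> i\<close> is 0, so the block of a
  degree-0 element lies in \<open>\<Gamma> 0\<close>, where fineness leaves scalars only.\<close>

lemma idem_corner: "i \<in> {1..sum_list p} \<Longrightarrow> a \<in> comp 0 \<Longrightarrow> \<exists>c. idem i \<odot> a \<odot> idem i = mat_scale c (idem i)"
proof -
  assume i: "i \<in> {1..sum_list p}" and a: "a \<in> comp 0"
  then have "slice a i i \<in> \<Gamma> 0" unfolding comp_iff by (metis diff_self)
  then obtain c where "slice a i i = mat_scale c (one_mat t)" using component_0 by blast
  then show ?thesis
    using idem_sandwich[OF i i comp_alg[OF a]] by (auto simp: emb_linear idem_def)
qed

lemma idem_neq_0: "idem i \<noteq> 0"
  unfolding idem_def using one_mat_neq_0 slice_emb_same[of i i "one_mat t"] by (metis slice_linear(3))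

lemma idem_idem: "idem i \<odot> idem i = idem i"
  unfolding idem_def by (simp add: emb_mult)

lemma primitive_idem: "i \<in> {1..sum_list p} \<Longrightarrow> degree_0.primitive (idem i)"
  unfolding degree_0.primitive_def using idem_comp idem_neq_0 idem_idem idem_corner by blast

end

subsection \<open>Invariants of a graded isomorphism\<close>

locale block_isomorphism =
  A: block_grading t \<Gamma> p \<gamma> + B: block_grading t' \<Gamma>' p' \<gamma>'
  for t t' :: nat and \<Gamma> \<Gamma>' :: "'g::{finite, ab_group_add} \<Rightarrow> (nat, 'k::field_char_0) imat set"
    and p p' \<gamma> \<gamma>' +
  fixes F
  assumes bij: "bij_betw F A.alg B.alg"
    and F_add: "\<And>a b. a \<in> A.alg \<Longrightarrow> b \<in> A.alg \<Longrightarrow> F (a + b) = F a + F b"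
    and F_scale: "\<And>c a. a \<in> A.alg \<Longrightarrow> F (mat_scale c a) = mat_scale c (F a)"
    and F_mult: "\<And>a b. a \<in> A.alg \<Longrightarrow> b \<in> A.alg \<Longrightarrow> F (a \<odot> b) = F a \<odot> F b"
    and F_comp: "\<And>g. F ` A.comp g = B.comp g"
begin

lemma F_alg: "a \<in> A.alg \<Longrightarrow> F a \<in> B.alg"
  using bij by (rule bij_betw_apply)

lemma F_surj:
  assumes "y \<in> B.alg"
  obtains x where "x \<in> A.alg" "y = F x"
proof -
  have "y \<in> F ` A.alg" using assms unfolding bij_betw_imp_surj_on[OF bij] .
  then show thesis by (rule imageE) (rule that)
qed

lemma F_inj: "a \<in> A.alg \<Longrightarrow> b \<in> A.alg \<Longrightarrow> F a = F b \<longleftrightarrow> a = b"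
  using bij_betw_imp_inj_on[OF bij] by (auto dest: inj_onD)

lemma F_comp_iff: "a \<in> A.alg \<Longrightarrow> F a \<in> B.comp g \<longleftrightarrow> a \<in> A.comp g"
proof
  assume a: "a \<in> A.alg" and "F a \<in> B.comp g"
  then obtain c where "c \<in> A.comp g" "F a = F c" unfolding F_comp[of g, symmetric] by blast
  then show "a \<in> A.comp g" using F_inj[OF a A.comp_alg] by simp
next
  assume "a \<in> A.comp g"
  then show "F a \<in> B.comp g" unfolding F_comp[of g, symmetric] by (rule imageI)
qed

lemma F_0: "F 0 = 0"
  using F_scale[OF imat.subspace_0[OF A.subspace_alg], of 0] by simp

lemma F_sum: "(\<And>x. x \<in> X \<Longrightarrow> h x \<in> A.alg) \<Longrightarrow> F (\<Sum>x\<in>X. h x) = (\<Sum>x\<in>X. F (h x))"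
  by (induction X rule: infinite_finite_induct)
     (simp_all add: F_0 F_add imat.subspace_sum[OF A.subspace_alg])

lemma primitive_F_idem:
  assumes i: "i \<in> {1..sum_list p}"
  shows "B.degree_0.primitive (F (A.idem i))"
  unfolding B.degree_0.primitive_def
proof (intro conjI ballI)
  note e = A.idem_alg[OF i]
  show "F (A.idem i) \<in> B.comp 0" using F_comp A.idem_comp[OF i] by blast
  show "F (A.idem i) \<noteq> 0"
    using F_inj[OF e imat.subspace_0[OF A.subspace_alg]] F_0 A.idem_neq_0 by simp
  show "F (A.idem i) \<odot> F (A.idem i) = F (A.idem i)"
    using F_mult[OF e e] by (simp add: A.idem_idem)
  fix y assume "y \<in> B.comp 0"
  then obtain x where x: "x \<in> A.comp 0" "y = F x" using F_comp by blast
  obtain c where "A.idem i \<odot> x \<odot> A.idem i = mat_scale c (A.idem i)"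
    using A.idem_corner[OF i x(1)] by blast
  then have "F (A.idem i \<odot> x \<odot> A.idem i) = mat_scale c (F (A.idem i))"
    by (simp add: F_scale e)
  then show "\<exists>c. F (A.idem i) \<odot> y \<odot> F (A.idem i) = mat_scale c (F (A.idem i))"
    using A.comp_alg[OF x(1)] e by (auto simp: x(2) F_mult A.alg_mult)
qed

lemma matching_of_idempotents:
  obtains \<tau> a b where "bij_betw \<tau> {1..sum_list p} {1..sum_list p'}"
    and "\<And>i. i \<in> {1..sum_list p} \<Longrightarrow> a i \<in> B.comp 0 \<and> b i \<in> B.comp 0 \<and>
      a i \<odot> B.idem (\<tau> i) = a i \<and> B.idem (\<tau> i) \<odot> b i = b i \<and>
      a i \<odot> b i = F (A.idem i) \<and> b i \<odot> a i = B.idem (\<tau> i)"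
proof -
  let ?I = "{1..sum_list p}" and ?J = "{1..sum_list p'}"
  let ?u = "\<Sum>i\<in>?I. A.idem i" and ?v = "\<Sum>j\<in>?J. B.idem j"
  have Fu: "F ?u = (\<Sum>i\<in>?I. F (A.idem i))" by (rule F_sum) (rule A.idem_alg)
  have u: "?u \<in> A.alg" using A.sum_idem_comp A.comp_alg by blast
  have v: "?v \<in> B.alg" using B.sum_idem_comp B.comp_alg by blast
  have unit: "F ?u \<odot> y = y" if "y \<in> B.alg" for y
  proof -
    obtain x where x: "x \<in> A.alg" "y = F x" using F_surj \<open>y \<in> B.alg\<close> by metis
    then show ?thesis using F_mult[OF u x(1)] A.sum_idem_mult(1)[OF x(1)] by simp
  qed
  \<comment> \<open>A left unit meets a right unit: the product of \<open>F ?u\<close> and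
    \<open>?v\<close> equals both, so the two families of idempotents decompose the same
    element.\<close>
  have uv: "F ?u = ?v" using unit[OF v] B.sum_idem_mult(2)[OF F_alg[OF u]] by simp
  have unit': "(\<Sum>i\<in>?I. F (A.idem i)) \<odot> y = y" if "y \<in> B.comp 0" for y
    using unit[OF B.comp_alg[OF that]] unfolding Fu .
  have char0: "m = n" if "(of_nat m :: 'k) = of_nat n" for m n using that by simp
  have "\<exists>\<tau>. bij_betw \<tau> ?I ?J \<and>
      (\<forall>i\<in>?I. B.degree_0.equivalent (F (A.idem i)) (B.idem (\<tau> i)))"
    by (rule B.degree_0.primitive_decompositions[OF char0 finite_atLeastAtMost finite_atLeastAtMost
          primitive_F_idem B.primitive_idem unit' uv[unfolded Fu]])
  then obtain \<tau> where \<tau>: "bij_betw \<tau> ?I ?J"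
    "\<forall>i\<in>?I. B.degree_0.equivalent (F (A.idem i)) (B.idem (\<tau> i))"
    by (elim exE conjE)
  from \<tau>(2) have "\<forall>i\<in>?I. \<exists>a b. a \<in> B.comp 0 \<and> b \<in> B.comp 0 \<and>
      a \<odot> B.idem (\<tau> i) = a \<and> B.idem (\<tau> i) \<odot> b = b \<and>
      a \<odot> b = F (A.idem i) \<and> b \<odot> a = B.idem (\<tau> i)"
    unfolding B.degree_0.equivalent_def by blast
  from bchoice[OF this] obtain a where "\<forall>i\<in>?I. \<exists>b. a i \<in> B.comp 0 \<and> b \<in> B.comp 0 \<and>
      a i \<odot> B.idem (\<tau> i) = a i \<and> B.idem (\<tau> i) \<odot> b = b \<and>
      a i \<odot> b = F (A.idem i) \<and> b \<odot> a i = B.idem (\<tau> i)"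
    by (rule exE)
  from bchoice[OF this] obtain b where ab: "\<forall>i\<in>?I. a i \<in> B.comp 0 \<and> b i \<in> B.comp 0 \<and>
      a i \<odot> B.idem (\<tau> i) = a i \<and> B.idem (\<tau> i) \<odot> b i = b i \<and>
      a i \<odot> b i = F (A.idem i) \<and> b i \<odot> a i = B.idem (\<tau> i)"
    by (rule exE)
  show thesis by (rule that[OF \<tau>(1), OF bspec[OF ab]])
qed

end

section \<open>Corners transported along the matching of idempotents\<close>

locale matched_block_isomorphism = block_isomorphism t t' \<Gamma> \<Gamma>' p p' \<gamma> \<gamma>' F
  for t t' :: nat and \<Gamma> \<Gamma>' :: "'g::{finite, ab_group_add} \<Rightarrow> (nat, 'k::field_char_0) imat set"
    and p p' \<gamma> \<gamma>' F +
  fixes \<tau> :: "nat \<Rightarrow> nat" and a b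
  assumes bij_\<tau>: "bij_betw \<tau> {1..sum_list p} {1..sum_list p'}"
    and match: "\<And>i. i \<in> {1..sum_list p} \<Longrightarrow> a i \<in> B.comp 0 \<and> b i \<in> B.comp 0 \<and>
      a i \<odot> B.idem (\<tau> i) = a i \<and> B.idem (\<tau> i) \<odot> b i = b i \<and>
      a i \<odot> b i = F (A.idem i) \<and> b i \<odot> a i = B.idem (\<tau> i)"
begin

lemma \<tau>_range: "i \<in> {1..sum_list p} \<Longrightarrow> \<tau> i \<in> {1..sum_list p'}"
  using bij_\<tau> by (rule bij_betw_apply)

lemma match_alg: "i \<in> {1..sum_list p} \<Longrightarrow> a i \<in> B.alg" "i \<in> {1..sum_list p} \<Longrightarrow> b i \<in> B.alg"
  using match B.comp_alg by blast+

lemma match_fin: "i \<in> {1..sum_list p} \<Longrightarrow> a i \<in> fin_mats" "i \<in> {1..sum_list p} \<Longrightarrow> b i \<in> fin_mats"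
  using match_alg B.alg_fin_mats by blast+

text \<open>\<open>F\<close> sends the corner \<open>(i, j)\<close> to the corner between
  \<open>F (A.idem i)\<close> and \<open>F (A.idem j)\<close>; the witnesses move it on to the block
  \<open>(\<tau> i, \<tau> j)\<close>. This is a conjugation of \<open>F\<close> carried out corner
  by corner.\<close>

definition push :: "nat \<Rightarrow> nat \<Rightarrow> (nat \<times> nat, 'k) imat \<Rightarrow> (nat \<times> nat, 'k) imat" where
  "push i j x = b i \<odot> F x \<odot> a j"

lemma push_alg:
  "i \<in> {1..sum_list p} \<Longrightarrow> j \<in> {1..sum_list p} \<Longrightarrow> x \<in> A.alg \<Longrightarrow> push i j x \<in> B.alg"
  unfolding push_def by (intro B.alg_mult match_alg F_alg)

lemma push_comp:
  assumes "i \<in> {1..sum_list p}" "j \<in> {1..sum_list p}" "x \<in> A.comp g"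
  shows "push i j x \<in> B.comp g"
proof -
  have "push i j x \<in> B.comp (0 + g + 0)"
    unfolding push_def using assms match F_comp by (intro B.comp_mult) blast+
  then show ?thesis by simp
qed

lemma push_eq_emb:
  assumes i: "i \<in> {1..sum_list p}" and j: "j \<in> {1..sum_list p}" and x: "x \<in> A.alg"
  shows "push i j x = emb (\<tau> i) (\<tau> j) (slice (push i j x) (\<tau> i) (\<tau> j))"
proof -
  have fm: "F x \<in> fin_mats" "B.idem (\<tau> i) \<in> fin_mats" "B.idem (\<tau> j) \<in> fin_mats"
    using F_alg[OF x] B.idem_alg \<tau>_range i j B.alg_fin_mats by blast+
  have "B.idem (\<tau> i) \<odot> push i j x \<odot> B.idem (\<tau> j)
      = (B.idem (\<tau> i) \<odot> b i) \<odot> F x \<odot> (a j \<odot> B.idem (\<tau> j))"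
    unfolding push_def by (simp add: mat_mult_assoc fm match_fin[OF i] match_fin[OF j])
  also have "\<dots> = push i j x" using match[OF i] match[OF j] by (simp add: push_def)
  finally show ?thesis
    using B.idem_sandwich[OF \<tau>_range[OF i] \<tau>_range[OF j] push_alg[OF assms]] by simp
qed

text \<open>\<open>a i \<odot> b i\<close> is \<open>F (A.idem i)\<close>, which acts as the
  identity from the left on the image of the corner, and likewise \<open>a j \<odot> b j\<close>
  from the right; so \<open>push\<close> is undone up to \<open>F\<close>.\<close>

lemma push_back:
  assumes i: "i \<in> {1..sum_list p}" and j: "j \<in> {1..sum_list p}" and x: "emb i j x \<in> A.alg"
  shows "a i \<odot> push i j (emb i j x) \<odot> b j = F (emb i j x)"
proof -
  have fm: "F (emb i j x) \<in> fin_mats" using F_alg[OF x] B.alg_fin_mats by blast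
  have "a i \<odot> push i j (emb i j x) \<odot> b j = (a i \<odot> b i) \<odot> F (emb i j x) \<odot> (a j \<odot> b j)"
    unfolding push_def by (simp add: mat_mult_assoc fm match_fin[OF i] match_fin[OF j])
  also have "\<dots> = F (A.idem i \<odot> emb i j x \<odot> A.idem j)"
    using match[OF i] match[OF j] A.idem_alg[OF i] A.idem_alg[OF j] x by (simp add: F_mult A.alg_mult)
  finally show ?thesis by (simp add: A.idem_emb[OF i j x])
qed

text \<open>The preimage arises by undoing the witnesses and then \<open>F\<close>. The last clause
  says that degrees are reflected, which later turns inclusions between components into
  equalities.\<close>

lemma push_surj:
  assumes i: "i \<in> {1..sum_list p}" and j: "j \<in> {1..sum_list p}"
    and y: "emb (\<tau> i) (\<tau> j) y \<in> B.alg"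
  obtains x where "emb i j x \<in> A.alg" "push i j (emb i j x) = emb (\<tau> i) (\<tau> j) y"
    "\<And>g. emb (\<tau> i) (\<tau> j) y \<in> B.comp g \<Longrightarrow> emb i j x \<in> A.comp g"
proof -
  let ?y = "emb (\<tau> i) (\<tau> j) y"
  let ?z = "a i \<odot> ?y \<odot> b j"
  have fm: "?y \<in> fin_mats" using y B.alg_fin_mats by blast
  have "?z \<in> B.alg" by (intro B.alg_mult match_alg i j y)
  then obtain w where w: "w \<in> A.alg" "F w = ?z" using F_surj by metis
  have e: "A.idem i \<in> A.alg" "A.idem j \<in> A.alg" using A.idem_alg i j by blast+
  \<comment> \<open>\<open>w\<close> lies in the corner \<open>(i, j)\<close>: the sandwich does not
    change its image, and \<open>F\<close> is injective.\<close>
  have "F (A.idem i \<odot> w \<odot> A.idem j) = (a i \<odot> b i) \<odot> ?z \<odot> (a j \<odot> b j)"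
    using match[OF i] match[OF j] w by (simp add: F_mult A.alg_mult e)
  also have "\<dots> = a i \<odot> (b i \<odot> a i) \<odot> ?y \<odot> (b j \<odot> a j) \<odot> b j"
    by (simp add: mat_mult_assoc fm match_fin[OF i] match_fin[OF j])
  also have "\<dots> = a i \<odot> ?y \<odot> (B.idem (\<tau> j) \<odot> b j)"
    using match[OF i] match[OF j] B.alg_fin_mats[OF B.idem_alg[OF \<tau>_range[OF j]]]
    by (simp add: mat_mult_assoc fm match_fin[OF i] match_fin[OF j])
  also have "\<dots> = F w" using match[OF j] w by simp
  finally have "A.idem i \<odot> w \<odot> A.idem j = w"
    using F_inj[OF A.alg_mult[OF A.alg_mult[OF e(1) w(1)] e(2)] w(1)] by blast
  then have w_emb: "emb i j (slice w i j) = w"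
    using A.idem_sandwich[OF i j w(1)] by simp
  have "push i j w = (b i \<odot> a i) \<odot> ?y \<odot> (b j \<odot> a j)"
    unfolding push_def w by (simp add: mat_mult_assoc fm match_fin[OF i] match_fin[OF j])
  also have "\<dots> = ?y"
    using match[OF i] match[OF j] B.idem_emb[OF \<tau>_range[OF i] \<tau>_range[OF j] y] by simp
  finally have "push i j w = ?y" .
  moreover have "w \<in> A.comp g" if "?y \<in> B.comp g" for g
  proof -
    have "?z \<in> B.comp (0 + g + 0)" using match i j that by (intro B.comp_mult) blast+
    then show ?thesis using F_comp_iff[OF w(1)] w(2) by simp
  qed
  ultimately show thesis using that[of "slice w i j"] w(1) w_emb by simp
qed

lemma push_nonzero:
  assumes "i \<in> {1..sum_list p}" "j \<in> {1..sum_list p}" "emb i j x \<in> A.alg" "x \<noteq> 0"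
  shows "push i j (emb i j x) \<noteq> 0"
proof
  assume "push i j (emb i j x) = 0"
  then have "F (emb i j x) = F 0" using push_back[OF assms(1-3)] by (simp add: F_0)
  then have "emb i j x = 0" using F_inj assms(3) imat.subspace_0[OF A.subspace_alg] by blast
  then show False using assms(4) slice_emb_same[of i j x] by simp
qed

text \<open>The invariant behind block structure, support and degrees: whether a corner has a
  nonzero part in degree \<open>g\<close>. It is evaluated where one side reduces to the degree-0
  component (positions and shifts), and at \<open>i = j = 1\<close>, where the elementary degrees
  cancel (support).\<close>

lemma corner_support:
  assumes i: "i \<in> {1..sum_list p}" and j: "j \<in> {1..sum_list p}"
  shows "(\<tau> i, \<tau> j) \<in> ut_positions p' \<and> \<Gamma>' (g - (\<gamma>' (\<tau> i) - \<gamma>' (\<tau> j))) \<noteq> {0}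
    \<longleftrightarrow> (i, j) \<in> ut_positions p \<and> \<Gamma> (g - (\<gamma> i - \<gamma> j)) \<noteq> {0}"
proof
  assume l: "(i, j) \<in> ut_positions p \<and> \<Gamma> (g - (\<gamma> i - \<gamma> j)) \<noteq> {0}"
  then obtain x where x: "x \<in> \<Gamma> (g - (\<gamma> i - \<gamma> j))" "x \<noteq> 0"
    using A.component_zero[of "g - (\<gamma> i - \<gamma> j)"] by blast
  then have e: "emb i j x \<in> A.comp g" using l A.emb_comp by blast
  then have ea: "emb i j x \<in> A.alg" by (rule A.comp_alg)
  let ?y = "slice (push i j (emb i j x)) (\<tau> i) (\<tau> j)"
  have "?y \<noteq> 0" using push_nonzero[OF i j ea x(2)] push_eq_emb[OF i j ea] emb_linear(3) by metis
  moreover have "?y \<in> \<Gamma>' (g - (\<gamma>' (\<tau> i) - \<gamma>' (\<tau> j)))" "(\<tau> i, \<tau> j) \<notin> ut_positions p' \<longrightarrow> ?y = 0"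
    using push_comp[OF i j e] unfolding B.comp_iff by blast+
  ultimately show "(\<tau> i, \<tau> j) \<in> ut_positions p' \<and> \<Gamma>' (g - (\<gamma>' (\<tau> i) - \<gamma>' (\<tau> j))) \<noteq> {0}" by blast
next
  assume r: "(\<tau> i, \<tau> j) \<in> ut_positions p' \<and> \<Gamma>' (g - (\<gamma>' (\<tau> i) - \<gamma>' (\<tau> j))) \<noteq> {0}"
  then obtain y where y: "y \<in> \<Gamma>' (g - (\<gamma>' (\<tau> i) - \<gamma>' (\<tau> j)))" "y \<noteq> 0"
    using B.component_zero[of "g - (\<gamma>' (\<tau> i) - \<gamma>' (\<tau> j))"] by blast
  then have e: "emb (\<tau> i) (\<tau> j) y \<in> B.comp g" using r B.emb_comp by blast
  obtain x where x: "push i j (emb i j x) = emb (\<tau> i) (\<tau> j) y" "emb i j x \<in> A.comp g"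
    using push_surj[OF i j B.comp_alg[OF e]] e by metis
  have "x \<noteq> 0"
  proof
    assume "x = 0"
    then have "emb (\<tau> i) (\<tau> j) y = 0" using x(1) by (simp add: emb_linear F_0 push_def)
    then show False using y(2) slice_emb_same[of "\<tau> i" "\<tau> j" y] by simp
  qed
  moreover have "x \<in> \<Gamma> (g - (\<gamma> i - \<gamma> j))" "(i, j) \<notin> ut_positions p \<longrightarrow> x = 0"
    using x(2) unfolding A.comp_iff by (metis slice_emb_same)+
  ultimately show "(i, j) \<in> ut_positions p \<and> \<Gamma> (g - (\<gamma> i - \<gamma> j)) \<noteq> {0}" by blast
qed

lemma one_component_nonzero: "\<Gamma> 0 \<noteq> {0}" "\<Gamma>' 0 \<noteq> {0}"
  using A.one_mat_component A.one_mat_neq_0 B.one_mat_component B.one_mat_neq_0 by blast+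

text \<open>With \<open>g\<close> the elementary degree of a position the component is that of
  degree 0, which contains the identity. Nonvanishing then only tests whether the position is
  admissible; each implication uses its own \<open>g\<close>.\<close>

lemma \<tau>_ut_positions:
  assumes "i \<in> {1..sum_list p}" "j \<in> {1..sum_list p}"
  shows "(\<tau> i, \<tau> j) \<in> ut_positions p' \<longleftrightarrow> (i, j) \<in> ut_positions p"
  using corner_support[OF assms, of "\<gamma> i - \<gamma> j"] corner_support[OF assms, of "\<gamma>' (\<tau> i) - \<gamma>' (\<tau> j)"]
    one_component_nonzero by (auto simp del: ex_in_conv)

lemma first_in: "sum_list p \<ge> 1 \<Longrightarrow> 1 \<in> {1..sum_list p}" by simp

lemma same_support:
  assumes "sum_list p \<ge> 1"
  shows "grading_support \<Gamma>' = grading_support \<Gamma>"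
  unfolding grading_support_def
  using corner_support[OF first_in first_in, OF assms assms]
    ut_positions_refl[OF first_in[OF assms]] ut_positions_refl[OF \<tau>_range[OF first_in[OF assms]]]
  by auto

text \<open>Corner \<open>(1, j)\<close> is nonzero in degree
  \<open>\<gamma> 1 - \<gamma> j\<close>, hence so is its counterpart. The degree this leaves for
  \<open>\<Gamma>'\<close> is, rearranged, the stated difference.\<close>

lemma shift_support:
  assumes "sum_list p \<ge> 1" and j: "j \<in> {1..sum_list p}"
  shows "\<gamma>' (\<tau> j) - \<gamma> j - (\<gamma>' (\<tau> 1) - \<gamma> 1) \<in> grading_support \<Gamma>"
proof -
  note one = first_in[OF assms(1)]
  have "\<Gamma>' (\<gamma> 1 - \<gamma> j - (\<gamma>' (\<tau> 1) - \<gamma>' (\<tau> j))) \<noteq> {0}"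
    using corner_support[OF one j, of "\<gamma> 1 - \<gamma> j"] ut_positions_first[OF j] one_component_nonzero by simp
  then have "\<gamma> 1 - \<gamma> j - (\<gamma>' (\<tau> 1) - \<gamma>' (\<tau> j)) \<in> grading_support \<Gamma>'"
    by (simp add: grading_support_def)
  then show ?thesis unfolding same_support[OF assms(1)] by (simp add: algebra_simps)
qed

text \<open>A diagonal corner is a copy of the matrix algebra with unchanged degrees, and
  \<open>push i i\<close> carries one such corner to another. It is multiplicative because
  \<open>a i \<odot> b i = F (A.idem i)\<close> is absorbed between two factors.\<close>

lemma matrix_algebras_isomorphic:
  assumes i: "i \<in> {1..sum_list p}"
  shows "graded_isomorphic (matrix_algebra t) \<Gamma> (matrix_algebra t') \<Gamma>'"
proof -
  note ut = ut_positions_refl[OF i] ut_positions_refl[OF \<tau>_range[OF i]]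
  define \<phi> where "\<phi> x = slice (push i i (emb i i x)) (\<tau> i) (\<tau> i)" for x
  have emb: "emb i i x \<in> A.alg" if "x \<in> matrix_algebra t" for x
    using A.emb_alg[OF ut(1) that] .
  have push: "push i i (emb i i x) = emb (\<tau> i) (\<tau> i) (\<phi> x)" if "x \<in> matrix_algebra t" for x
    unfolding \<phi>_def using push_eq_emb[OF i i emb[OF that]] .
  have range: "\<phi> x \<in> matrix_algebra t'" if "x \<in> matrix_algebra t" for x
    using push_alg[OF i i emb[OF that]] unfolding \<phi>_def B.alg_iff by blast
  have fin: "F (emb i i x) \<in> fin_mats" if "x \<in> matrix_algebra t" for x
    using emb[OF that] F_alg B.alg_fin_mats by blast
  have add: "\<phi> (x + y) = \<phi> x + \<phi> y" if "x \<in> matrix_algebra t" "y \<in> matrix_algebra t" for x y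
    unfolding \<phi>_def push_def using that
    by (simp add: emb_linear F_add emb mat_mult_add_left mat_mult_add_right fin match_fin[OF i])
  have scale: "\<phi> (mat_scale c x) = mat_scale c (\<phi> x)" if "x \<in> matrix_algebra t" for c x
    unfolding \<phi>_def push_def using that
    by (simp add: emb_linear F_scale emb fin match_fin[OF i])
  have mult: "\<phi> (x \<odot> y) = \<phi> x \<odot> \<phi> y" if x: "x \<in> matrix_algebra t" and y: "y \<in> matrix_algebra t" for x y
  proof -
    note e = emb[OF x] emb[OF y] A.idem_alg[OF i]
    have "emb (\<tau> i) (\<tau> i) (\<phi> x \<odot> \<phi> y) = push i i (emb i i x) \<odot> push i i (emb i i y)"
      unfolding push[OF x] push[OF y] B.emb_mult[OF range[OF x] range[OF y]] by (rule refl)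
    also have "\<dots> = b i \<odot> (F (emb i i x) \<odot> (a i \<odot> b i) \<odot> F (emb i i y)) \<odot> a i"
      unfolding push_def by (simp add: mat_mult_assoc fin x y match_fin[OF i])
    also have "\<dots> = push i i (emb i i x \<odot> A.idem i \<odot> emb i i y)"
      unfolding push_def using match[OF i] by (simp add: F_mult A.alg_mult e)
    also have "emb i i x \<odot> A.idem i \<odot> emb i i y = emb i i (x \<odot> y)"
      unfolding A.idem_def using x y by (simp add: A.emb_mult)
    also have "push i i \<dots> = emb (\<tau> i) (\<tau> i) (\<phi> (x \<odot> y))"
      using push[OF matrix_algebra_mult[OF x y]] .
    finally show ?thesis by (metis slice_emb_same)
  qed
  have inj: "inj_on \<phi> (matrix_algebra t)"
  proof (rule inj_onI)
    fix x y assume *: "x \<in> matrix_algebra t" "y \<in> matrix_algebra t" "\<phi> x = \<phi> y"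
    then have "F (emb i i x) = F (emb i i y)"
      using push_back[OF i i emb] push by metis
    then have "emb i i x = emb i i y" using F_inj emb * by blast
    then show "x = y" by (metis slice_emb_same)
  qed
  have onto: "\<exists>x\<in>matrix_algebra t. \<phi> x = y \<and> (\<forall>g. y \<in> \<Gamma>' g \<longrightarrow> x \<in> \<Gamma> g)" if y: "y \<in> matrix_algebra t'" for y
  proof -
    obtain x where x: "emb i i x \<in> A.alg" "push i i (emb i i x) = emb (\<tau> i) (\<tau> i) y"
      "\<And>g. emb (\<tau> i) (\<tau> i) y \<in> B.comp g \<Longrightarrow> emb i i x \<in> A.comp g"
      using push_surj[OF i i B.emb_alg[OF ut(2) y]] by blast
    have "x \<in> matrix_algebra t" using x(1) unfolding A.alg_iff by (metis slice_emb_same)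
    moreover have "\<phi> x = y" unfolding \<phi>_def x(2) by simp
    moreover have "x \<in> \<Gamma> g" if "y \<in> \<Gamma>' g" for g
    proof -
      have "emb (\<tau> i) (\<tau> i) y \<in> B.comp g" using that by (intro B.emb_comp ut) simp
      from x(3)[OF this] have "slice (emb i i x) i i \<in> \<Gamma> (g - (\<gamma> i - \<gamma> i))" unfolding A.comp_iff by blast
      then show ?thesis by simp
    qed
    ultimately show ?thesis by blast
  qed
  have degree: "\<phi> x \<in> \<Gamma>' g" if "x \<in> \<Gamma> g" for x g
  proof -
    have "emb i i x \<in> A.comp g" using that by (intro A.emb_comp ut) simp
    from push_comp[OF i i this] have "\<phi> x \<in> \<Gamma>' (g - (\<gamma>' (\<tau> i) - \<gamma>' (\<tau> i)))"
      unfolding \<phi>_def B.comp_iff by blast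
    then show ?thesis by simp
  qed
  have "bij_betw \<phi> (matrix_algebra t) (matrix_algebra t')"
    using inj range onto by (intro bij_betw_imageI) blast+
  moreover have "\<phi> ` \<Gamma> g = \<Gamma>' g" for g
    using degree onto B.component_matrix_algebra by blast
  ultimately show ?thesis
    unfolding graded_isomorphic_def using add scale mult by blast
qed

end

subsection \<open>Constructing a graded isomorphism\<close>

lemma graded_isomorphicE:
  assumes "graded_isomorphic A \<Gamma> B \<Delta>"
  obtains f where "bij_betw f A B"
    "\<And>a b. a \<in> A \<Longrightarrow> b \<in> A \<Longrightarrow> f (a + b) = f a + f b"
    "\<And>c a. a \<in> A \<Longrightarrow> f (mat_scale c a) = mat_scale c (f a)"
    "\<And>a b. a \<in> A \<Longrightarrow> b \<in> A \<Longrightarrow> f (a \<odot> b) = f a \<odot> f b"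
    "\<And>g. f ` \<Gamma> g = \<Delta> g"
proof -
  from assms obtain f where f: "bij_betw f A B \<and>
        (\<forall>a\<in>A. \<forall>b\<in>A. f (a + b) = f a + f b) \<and>
        (\<forall>c. \<forall>a\<in>A. f (mat_scale c a) = mat_scale c (f a)) \<and>
        (\<forall>a\<in>A. \<forall>b\<in>A. f (a \<odot> b) = f a \<odot> f b) \<and>
        (\<forall>g. f ` \<Gamma> g = \<Delta> g)"
    unfolding graded_isomorphic_def by (rule exE)
  show thesis by (rule that[of f]) (simp_all add: f)
qed

text \<open>\<open>h k\<close> is indexed by target positions and stands for
  \<open>h (\<sigma> k)\<close> of the theorem. The units \<open>u k\<close>, \<open>v k\<close> are
  given for every natural number, so the block maps need no range conditions; only
  \<open>shift\<close> is tied to the actual range.\<close>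

locale regrading = A: block_grading t \<Gamma> p \<gamma> + B: block_grading t' \<Gamma>' p \<gamma>'
  for t t' :: nat and \<Gamma> \<Gamma>' :: "'g::{finite, ab_group_add} \<Rightarrow> (nat, 'k::field) imat set"
    and p \<gamma> \<gamma>' +
  fixes \<phi> :: "(nat, 'k) imat \<Rightarrow> (nat, 'k) imat" and s :: 'g and h :: "nat \<Rightarrow> 'g" and \<sigma> u v
  assumes bij: "bij_betw \<phi> (matrix_algebra t) (matrix_algebra t')"
    and add: "\<And>x y. x \<in> matrix_algebra t \<Longrightarrow> y \<in> matrix_algebra t \<Longrightarrow> \<phi> (x + y) = \<phi> x + \<phi> y"
    and scale: "\<And>c x. x \<in> matrix_algebra t \<Longrightarrow> \<phi> (mat_scale c x) = mat_scale c (\<phi> x)"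
    and mult: "\<And>x y. x \<in> matrix_algebra t \<Longrightarrow> y \<in> matrix_algebra t \<Longrightarrow> \<phi> (x \<odot> y) = \<phi> x \<odot> \<phi> y"
    and degree: "\<And>g. \<phi> ` \<Gamma> g = \<Gamma>' g"
    and u: "\<And>k. u k \<in> \<Gamma>' (h k)" and v: "\<And>k. v k \<in> \<Gamma>' (- h k)"
    and uv: "\<And>k. u k \<odot> v k = one_mat t'" and vu: "\<And>k. v k \<odot> u k = one_mat t'"
    and \<sigma>: "\<sigma> permutes {1..sum_list p}"
    and blocks: "\<forall>k\<in>{1..length p}. \<sigma> ` block p k = block p k"
    and shift: "\<And>k. k \<in> {1..sum_list p} \<Longrightarrow> \<gamma>' k = \<gamma> (\<sigma> k) + h k + s"
begin

definition \<psi> :: "nat \<Rightarrow> nat \<Rightarrow> (nat, 'k) imat \<Rightarrow> (nat, 'k) imat" where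
  "\<psi> k l x = v k \<odot> \<phi> x \<odot> u l"

definition \<Psi> :: "(nat \<times> nat, 'k) imat \<Rightarrow> (nat \<times> nat, 'k) imat" where
  "\<Psi> a = (\<lambda>(i, k) (j, l). \<psi> k l (slice a (\<sigma> k) (\<sigma> l)) i j)"

lemma slice_\<Psi> [simp]: "slice (\<Psi> a) k l = \<psi> k l (slice a (\<sigma> k) (\<sigma> l))"
  by (simp add: slice_def \<Psi>_def)

lemma in_t: "u k \<in> matrix_algebra t'" "v k \<in> matrix_algebra t'"
    "x \<in> matrix_algebra t \<Longrightarrow> \<phi> x \<in> matrix_algebra t'"
  using u v B.component_matrix_algebra bij_betw_apply[OF bij] by blast+

lemmas in_fin = in_t[THEN fin_mats_matrix_algebra]

lemma \<psi>_in: "x \<in> matrix_algebra t \<Longrightarrow> \<psi> k l x \<in> matrix_algebra t'"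
  unfolding \<psi>_def by (intro matrix_algebra_mult in_t)

lemma \<phi>_0: "\<phi> 0 = 0"
  using scale[of 0 0] by simp

lemma \<psi>_0 [simp]: "\<psi> k l 0 = 0"
  by (simp add: \<psi>_def \<phi>_0)

lemma \<psi>_add: "x \<in> matrix_algebra t \<Longrightarrow> y \<in> matrix_algebra t \<Longrightarrow> \<psi> k l (x + y) = \<psi> k l x + \<psi> k l y"
  by (simp add: \<psi>_def add mat_mult_add_left mat_mult_add_right in_fin)

lemma \<psi>_scale: "x \<in> matrix_algebra t \<Longrightarrow> \<psi> k l (mat_scale c x) = mat_scale c (\<psi> k l x)"
  by (simp add: \<psi>_def scale in_fin)

lemma \<psi>_sum: "(\<And>x. x \<in> X \<Longrightarrow> f x \<in> matrix_algebra t) \<Longrightarrow> \<psi> k l (\<Sum>x\<in>X. f x) = (\<Sum>x\<in>X. \<psi> k l (f x))"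
  by (induction X rule: infinite_finite_induct)
     (simp_all add: \<psi>_add imat.subspace_sum[OF subspace_matrix_algebra])

text \<open>The twists at the middle index cancel, since \<open>u m \<odot> v m\<close> is the unit;
  hence the block maps fit together in a matrix product.\<close>

lemma \<psi>_mult:
  assumes x: "x \<in> matrix_algebra t" and y: "y \<in> matrix_algebra t"
  shows "\<psi> k l (x \<odot> y) = \<psi> k m x \<odot> \<psi> m l y"
proof -
  have "\<psi> k m x \<odot> \<psi> m l y = v k \<odot> (\<phi> x \<odot> (u m \<odot> v m)) \<odot> \<phi> y \<odot> u l"
    unfolding \<psi>_def by (simp add: mat_mult_assoc in_fin x y)
  also have "\<dots> = v k \<odot> (\<phi> x \<odot> \<phi> y) \<odot> u l"
    by (simp add: uv in_t x) (simp add: mat_mult_assoc in_fin x y)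
  finally show ?thesis by (simp add: \<psi>_def mult x y)
qed

lemma \<psi>_undo:
  assumes "y \<in> matrix_algebra t'"
  shows "v k \<odot> (u k \<odot> y \<odot> v l) \<odot> u l = y" "u k \<odot> (v k \<odot> y \<odot> u l) \<odot> v l = y"
proof -
  note f = fin_mats_matrix_algebra[OF assms]
  have "v k \<odot> (u k \<odot> y \<odot> v l) \<odot> u l = (v k \<odot> u k) \<odot> y \<odot> (v l \<odot> u l)"
    "u k \<odot> (v k \<odot> y \<odot> u l) \<odot> v l = (u k \<odot> v k) \<odot> y \<odot> (u l \<odot> v l)"
    by (simp_all add: mat_mult_assoc in_fin f)
  then show "v k \<odot> (u k \<odot> y \<odot> v l) \<odot> u l = y" "u k \<odot> (v k \<odot> y \<odot> u l) \<odot> v l = y"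
    by (simp_all add: uv vu assms)
qed

lemma \<psi>_inj: "x \<in> matrix_algebra t \<Longrightarrow> y \<in> matrix_algebra t \<Longrightarrow> \<psi> k l x = \<psi> k l y \<Longrightarrow> x = y"
proof -
  assume *: "x \<in> matrix_algebra t" "y \<in> matrix_algebra t" "\<psi> k l x = \<psi> k l y"
  then have "u k \<odot> (v k \<odot> \<phi> x \<odot> u l) \<odot> v l = u k \<odot> (v k \<odot> \<phi> y \<odot> u l) \<odot> v l"
    unfolding \<psi>_def by simp
  then have "\<phi> x = \<phi> y" by (simp add: \<psi>_undo in_t *)
  then show "x = y" using bij_betw_imp_inj_on[OF bij] * by (auto dest: inj_onD)
qed

lemma \<psi>_surj:
  assumes "y \<in> matrix_algebra t'"
  shows "\<exists>x\<in>matrix_algebra t. \<psi> k l x = y \<and> (\<forall>g. y \<in> \<Gamma>' (g - h k + h l) \<longrightarrow> x \<in> \<Gamma> g)"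
proof -
  let ?z = "u k \<odot> y \<odot> v l"
  have "?z \<in> matrix_algebra t'" by (intro matrix_algebra_mult in_t assms)
  then have "?z \<in> \<phi> ` matrix_algebra t" unfolding bij_betw_imp_surj_on[OF bij] .
  then obtain x where x: "x \<in> matrix_algebra t" "?z = \<phi> x" by (rule imageE) simp
  have "\<psi> k l x = y" unfolding \<psi>_def x(2)[symmetric] by (rule \<psi>_undo[OF assms])
  moreover have "x \<in> \<Gamma> g" if "y \<in> \<Gamma>' (g - h k + h l)" for g
  proof -
    have "?z \<in> \<Gamma>' (h k + (g - h k + h l) + (- h l))" by (intro B.component_mult u v that)
    then have "\<phi> x \<in> \<phi> ` \<Gamma> g" unfolding degree x(2)[symmetric] by (simp add: algebra_simps)
    then obtain x' where x': "x' \<in> \<Gamma> g" "\<phi> x = \<phi> x'" by (rule imageE) simp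
    then have "x = x'"
      using bij_betw_imp_inj_on[OF bij] x(1) A.component_matrix_algebra by (metis inj_onD)
    then show ?thesis using x' by simp
  qed
  ultimately show ?thesis using x(1) by blast
qed

lemma \<psi>_degree: "x \<in> \<Gamma> g \<Longrightarrow> \<psi> k l x \<in> \<Gamma>' (g - h k + h l)"
proof -
  assume "x \<in> \<Gamma> g"
  then have "\<phi> x \<in> \<Gamma>' g" using degree by blast
  then have "\<psi> k l x \<in> \<Gamma>' (- h k + g + h l)"
    unfolding \<psi>_def by (intro B.component_mult u v)
  then show ?thesis by (simp add: algebra_simps)
qed

lemma \<sigma>_ut: "(\<sigma> i, \<sigma> j) \<in> ut_positions p \<longleftrightarrow> (i, j) \<in> ut_positions p"
  by (rule ut_positions_image_iff[OF \<sigma> blocks])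

lemma slice_alg: "a \<in> A.alg \<Longrightarrow> slice a k l \<in> matrix_algebra t"
  unfolding A.alg_iff by blast

lemma \<Psi>_alg:
  assumes a: "a \<in> A.alg"
  shows "\<Psi> a \<in> B.alg"
proof -
  have "slice a (\<sigma> k) (\<sigma> l) = 0" if "(k, l) \<notin> ut_positions p" for k l
    using a that \<sigma>_ut[of k l] unfolding A.alg_iff by blast
  then show ?thesis unfolding B.alg_iff by (simp add: \<psi>_in slice_alg[OF a])
qed

text \<open>The common summand \<open>s\<close> cancels in the difference, and what remains of
  \<open>h\<close> is exactly the change of degree made by \<open>\<psi> k l\<close>.\<close>

lemma shift_ut:
  assumes "(k, l) \<in> ut_positions p"
  shows "g - (\<gamma>' k - \<gamma>' l) = g - (\<gamma> (\<sigma> k) - \<gamma> (\<sigma> l)) - h k + h l"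
proof -
  have "k \<in> {1..sum_list p}" "l \<in> {1..sum_list p}" using assms ut_positions_subset[of p] by blast+
  then show ?thesis by (simp add: shift algebra_simps del: atLeastAtMost_iff)
qed

lemma \<Psi>_comp:
  assumes "a \<in> A.comp g"
  shows "\<Psi> a \<in> B.comp g"
proof -
  have *: "slice a (\<sigma> k) (\<sigma> l) \<in> \<Gamma> (g - (\<gamma> (\<sigma> k) - \<gamma> (\<sigma> l)))"
    "(k, l) \<notin> ut_positions p \<Longrightarrow> slice a (\<sigma> k) (\<sigma> l) = 0" for k l
    using assms \<sigma>_ut[of k l] unfolding A.comp_iff by blast+
  have "\<psi> k l (slice a (\<sigma> k) (\<sigma> l)) \<in> \<Gamma>' (g - (\<gamma>' k - \<gamma>' l))" for k l
  proof (cases "(k, l) \<in> ut_positions p")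
    case True
    show ?thesis unfolding shift_ut[OF True] by (rule \<psi>_degree[OF *(1)])
  next
    case False
    then show ?thesis using *(2) B.component_zero by simp
  qed
  then show ?thesis unfolding B.comp_iff using *(2) by simp
qed

lemma \<Psi>_inj: "inj_on \<Psi> A.alg"
proof (rule inj_onI, rule slice_eqI)
  fix a b k l assume *: "a \<in> A.alg" "b \<in> A.alg" "\<Psi> a = \<Psi> b"
  have "slice (\<Psi> a) (inv \<sigma> k) (inv \<sigma> l) = slice (\<Psi> b) (inv \<sigma> k) (inv \<sigma> l)" using *(3) by simp
  then show "slice a k l = slice b k l"
    using \<psi>_inj[OF slice_alg[OF *(1)] slice_alg[OF *(2)]]
    by (simp add: permutes_inverses[OF \<sigma>])
qed

lemma \<Psi>_surj:
  assumes y: "y \<in> B.alg"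
  shows "\<exists>a\<in>A.alg. \<Psi> a = y \<and> (\<forall>g. y \<in> B.comp g \<longrightarrow> a \<in> A.comp g)"
proof -
  have "\<forall>k l. \<exists>x. x \<in> matrix_algebra t \<and> \<psi> k l x = slice y k l \<and>
      (\<forall>g. slice y k l \<in> \<Gamma>' (g - h k + h l) \<longrightarrow> x \<in> \<Gamma> g)"
    using \<psi>_surj y unfolding B.alg_iff by blast
  then obtain X where X: "\<And>k l. X k l \<in> matrix_algebra t" "\<And>k l. \<psi> k l (X k l) = slice y k l"
    "\<And>k l g. slice y k l \<in> \<Gamma>' (g - h k + h l) \<Longrightarrow> X k l \<in> \<Gamma> g"
    by metis
  \<comment> \<open>Block \<open>(k, l)\<close> of an argument of \<open>\<Psi>\<close> ends up at
    \<open>(inv \<sigma> k, inv \<sigma> l)\<close>, so \<open>X\<close> is read at the inverse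
    positions.\<close>
  define a where "a = (\<lambda>(i, k) (j, l). X (inv \<sigma> k) (inv \<sigma> l) i j)"
  have a: "slice a k l = X (inv \<sigma> k) (inv \<sigma> l)" for k l by (simp add: a_def slice_def)
  have ut: "(inv \<sigma> k, inv \<sigma> l) \<in> ut_positions p \<longleftrightarrow> (k, l) \<in> ut_positions p" for k l
    using \<sigma>_ut[of "inv \<sigma> k" "inv \<sigma> l"] by (simp add: permutes_inverses[OF \<sigma>])
  have X0: "X k l = 0" if "(k, l) \<notin> ut_positions p" for k l
  proof -
    have "\<psi> k l (X k l) = \<psi> k l 0" using X(2) y that unfolding B.alg_iff by simp
    then show ?thesis using \<psi>_inj X(1) zero_matrix_algebra by blast
  qed
  have "a \<in> A.alg" unfolding A.alg_iff a using X(1) X0 ut by blast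
  moreover have "\<Psi> a = y"
    by (rule slice_eqI) (simp add: a permutes_inverses[OF \<sigma>] X(2))
  moreover have "a \<in> A.comp g" if "y \<in> B.comp g" for g
  proof -
    have "X (inv \<sigma> k) (inv \<sigma> l) \<in> \<Gamma> (g - (\<gamma> k - \<gamma> l))" for k l
    proof (cases "(k, l) \<in> ut_positions p")
      case True
      let ?k = "inv \<sigma> k" and ?l = "inv \<sigma> l"
      have "slice y ?k ?l \<in> \<Gamma>' (g - (\<gamma>' ?k - \<gamma>' ?l))" using that unfolding B.comp_iff by blast
      then have "slice y ?k ?l \<in> \<Gamma>' (g - (\<gamma> k - \<gamma> l) - h ?k + h ?l)"
        using True shift_ut[of ?k ?l g] by (simp add: ut permutes_inverses[OF \<sigma>])
      then show ?thesis by (rule X(3))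
    next
      case False
      then show ?thesis using X0 ut A.component_zero by simp
    qed
    then show ?thesis unfolding A.comp_iff a using X0 ut by blast
  qed
  ultimately show ?thesis by blast
qed

lemma \<Psi>_mult:
  assumes a: "a \<in> A.alg" and b: "b \<in> A.alg"
  shows "\<Psi> (a \<odot> b) = \<Psi> a \<odot> \<Psi> b"
proof (rule slice_eqI)
  fix k l
  let ?N = "{1..sum_list p}"
  have "slice (\<Psi> (a \<odot> b)) k l = (\<Sum>m\<in>?N. \<psi> k l (slice a (\<sigma> k) m \<odot> slice b m (\<sigma> l)))"
    unfolding slice_\<Psi> A.slice_mult_alg[OF a]
    by (intro \<psi>_sum matrix_algebra_mult slice_alg a b)
  \<comment> \<open>The summation index is permuted by \<open>\<sigma>\<close>, to make the inner
    position match the blocks that \<open>\<Psi>\<close> reads.\<close>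
  also have "\<dots> = (\<Sum>m\<in>?N. \<psi> k l (slice a (\<sigma> k) (\<sigma> m) \<odot> slice b (\<sigma> m) (\<sigma> l)))"
    using sum.permute[OF \<sigma>] by (auto simp: comp_def)
  also have "\<dots> = (\<Sum>m\<in>?N. slice (\<Psi> a) k m \<odot> slice (\<Psi> b) m l)"
    unfolding slice_\<Psi> by (intro sum.cong refl \<psi>_mult slice_alg a b)
  also have "\<dots> = slice (\<Psi> a \<odot> \<Psi> b) k l"
    by (rule B.slice_mult_alg[OF \<Psi>_alg[OF a], symmetric])
  finally show "slice (\<Psi> (a \<odot> b)) k l = slice (\<Psi> a \<odot> \<Psi> b) k l" .
qed

lemma graded_isomorphic_alg: "graded_isomorphic A.alg A.comp B.alg B.comp"
  unfolding graded_isomorphic_def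
proof (intro exI[of _ \<Psi>] conjI ballI allI)
  show "bij_betw \<Psi> A.alg B.alg"
    using \<Psi>_inj \<Psi>_alg \<Psi>_surj by (intro bij_betw_imageI) blast+
  show "\<Psi> (a + b) = \<Psi> a + \<Psi> b" if "a \<in> A.alg" "b \<in> A.alg" for a b
    using that by (intro slice_eqI) (simp add: \<psi>_add slice_alg)
  show "\<Psi> (mat_scale c a) = mat_scale c (\<Psi> a)" if "a \<in> A.alg" for c a
    using that by (intro slice_eqI) (simp add: \<psi>_scale slice_alg)
  show "\<Psi> (a \<odot> b) = \<Psi> a \<odot> \<Psi> b" if "a \<in> A.alg" "b \<in> A.alg" for a b
    using that by (rule \<Psi>_mult)
  show "\<Psi> ` A.comp g = B.comp g" for g
    using \<Psi>_comp \<Psi>_surj B.comp_alg by blast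
qed

end

theorem corollary4:
  fixes \<Gamma> \<Gamma>' :: "'g::{finite, ab_group_add} \<Rightarrow> (nat, 'k::{alg_closed_field, field_char_0}) imat set"
    and t t' :: nat and p p' :: "nat list" and \<gamma> \<gamma>' :: "nat \<Rightarrow> 'g"
  assumes "t \<ge> 1" and "t' \<ge> 1"
    and "length p \<ge> 1" and "length p' = length p"
    and "\<forall>x\<in>set p. x \<ge> 1" and "\<forall>x\<in>set p'. x \<ge> 1"
    and "is_grading (matrix_algebra t) \<Gamma>" and "is_fine \<Gamma>"
    and "is_grading (matrix_algebra t') \<Gamma>'" and "is_fine \<Gamma>'"
  shows
    "graded_isomorphic
        (tensor (matrix_algebra t) (UT_algebra p))
        (tensor_grading \<Gamma> (elementary_grading p \<gamma>))
        (tensor (matrix_algebra t') (UT_algebra p'))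
        (tensor_grading \<Gamma>' (elementary_grading p' \<gamma>'))
     \<longleftrightarrow>
     graded_isomorphic (matrix_algebra t) \<Gamma> (matrix_algebra t') \<Gamma>' \<and>
     p = p' \<and>
     (\<exists>(g::'g) (h :: nat \<Rightarrow> 'g) (\<sigma> :: nat \<Rightarrow> nat).
        (\<forall>i\<in>{1..sum_list p}. h i \<in> grading_support \<Gamma>) \<and>
        \<sigma> permutes {1..sum_list p} \<and>
        (\<forall>k\<in>{1..length p}. \<sigma> ` block p k = block p k) \<and>
        (\<forall>i\<in>{1..sum_list p}. \<gamma>' i = \<gamma> (\<sigma> i) + h (\<sigma> i) + g))"
    (is "?lhs \<longleftrightarrow> ?M \<and> _ \<and> ?E")
proof -
  interpret A: block_grading t \<Gamma> p \<gamma> using assms by unfold_locales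
  interpret B: block_grading t' \<Gamma>' p' \<gamma>' using assms by unfold_locales
  let ?N = "{1..sum_list p}"
  have "p \<noteq> []" using assms(3) by auto
  then have n: "sum_list p \<ge> 1" using assms(5) by (cases p) auto
  have lhs: "?lhs \<longleftrightarrow> graded_isomorphic A.alg A.comp B.alg B.comp"
    by (simp only: A.tensor_eq_alg A.tensor_grading_eq_comp B.tensor_eq_alg B.tensor_grading_eq_comp)
  show ?thesis
  proof
    assume ?lhs
    then have "graded_isomorphic A.alg A.comp B.alg B.comp" unfolding lhs .
    then obtain F where F: "bij_betw F A.alg B.alg"
      "\<And>a b. a \<in> A.alg \<Longrightarrow> b \<in> A.alg \<Longrightarrow> F (a + b) = F a + F b"
      "\<And>c a. a \<in> A.alg \<Longrightarrow> F (mat_scale c a) = mat_scale c (F a)"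
      "\<And>a b. a \<in> A.alg \<Longrightarrow> b \<in> A.alg \<Longrightarrow> F (a \<odot> b) = F a \<odot> F b"
      "\<And>g. F ` A.comp g = B.comp g"
      by (rule graded_isomorphicE) (rule that)
    interpret F: block_isomorphism t t' \<Gamma> \<Gamma>' p p' \<gamma> \<gamma>' F
      by unfold_locales (fact F)+
    obtain \<tau> a b where \<tau>: "bij_betw \<tau> ?N {1..sum_list p'}"
      and match: "\<And>i. i \<in> ?N \<Longrightarrow> a i \<in> B.comp 0 \<and> b i \<in> B.comp 0 \<and>
      a i \<odot> B.idem (\<tau> i) = a i \<and> B.idem (\<tau> i) \<odot> b i = b i \<and>
      a i \<odot> b i = F (A.idem i) \<and> b i \<odot> a i = B.idem (\<tau> i)"
      by (rule F.matching_of_idempotents) (rule that)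
    interpret T: matched_block_isomorphism t t' \<Gamma> \<Gamma>' p p' \<gamma> \<gamma>' F \<tau> a b
      by unfold_locales (fact \<tau>, fact match)
    have pp: "p = p'" and \<tau>_block: "\<And>i k. i \<in> block p k \<Longrightarrow> k \<in> {1..length p} \<Longrightarrow> \<tau> i \<in> block p k"
      using ut_positions_bij_blocks[OF assms(5,6) \<tau> T.\<tau>_ut_positions] by blast+
    \<comment> \<open>\<open>\<tau>\<close> is controlled only on the range, while
      \<open>permutes\<close> requires the identity outside.\<close>
    define \<rho> where "\<rho> i = (if i \<in> ?N then \<tau> i else i)" for i
    have \<rho>: "\<rho> permutes ?N"
    proof (rule bij_imp_permutes)
      show "bij_betw \<rho> ?N ?N"
        using \<tau> pp bij_betw_cong[of ?N \<rho> \<tau>] by (simp add: \<rho>_def del: atLeastAtMost_iff)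
    qed (auto simp: \<rho>_def)
    \<comment> \<open>The inclusion comes from \<open>\<tau>_block\<close>; injectivity and
      finiteness make it an equality.\<close>
    have \<rho>_block: "\<rho> ` block p k = block p k" if k: "k \<in> {1..length p}" for k
    proof (rule card_subset_eq)
      show "finite (block p k)" by (simp add: block_def)
      show "\<rho> ` block p k \<subseteq> block p k"
        using \<tau>_block[OF _ k] block_subset[of p k] unfolding \<rho>_def by auto
      show "card (\<rho> ` block p k) = card (block p k)"
        using permutes_inj[OF \<rho>] by (intro card_image) (blast intro: inj_on_subset)
    qed
    \<comment> \<open>The common shift is read off at index 1, and \<open>h\<close> is the
      remainder, so \<open>h 1 = 0\<close>.\<close>
    define g where "g = \<gamma>' (\<tau> 1) - \<gamma> 1"
    define h where "h i = \<gamma>' (\<tau> i) - \<gamma> i - g" for i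
    have ?E
    proof (intro exI conjI ballI)
      show "h i \<in> grading_support \<Gamma>" if "i \<in> ?N" for i
        unfolding h_def g_def by (rule T.shift_support[OF n that])
      \<comment> \<open>The matching leads from source indices to target indices, whereas the
        permutation of the statement leads from target to source; hence the inverse.\<close>
      show "inv \<rho> permutes ?N" by (rule permutes_inv[OF \<rho>])
      show "inv \<rho> ` block p k = block p k" if "k \<in> {1..length p}" for k
      proof -
        have "inv \<rho> ` \<rho> ` block p k = block p k"
          by (simp add: image_image permutes_inverses[OF \<rho>])
        then show ?thesis by (simp only: \<rho>_block[OF that])
      qed
      show "\<gamma>' i = \<gamma> (inv \<rho> i) + h (inv \<rho> i) + g" if "i \<in> ?N" for i
      proof -
        have "inv \<rho> i \<in> ?N" using that permutes_in_image[OF permutes_inv[OF \<rho>]] by blast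
        then have "\<tau> (inv \<rho> i) = \<rho> (inv \<rho> i)" by (simp only: \<rho>_def if_True)
        also have "\<dots> = i" by (rule permutes_inverses(1)[OF \<rho>])
        finally show ?thesis by (simp add: h_def)
      qed
    qed
    moreover have ?M by (rule T.matrix_algebras_isomorphic[OF T.first_in[OF n]])
    ultimately show "?M \<and> p = p' \<and> ?E" using pp by blast
  next
    assume "?M \<and> p = p' \<and> ?E"
    then have ?M and pp: "p = p'" and ?E by blast+
    obtain \<phi> where bij: "bij_betw \<phi> (matrix_algebra t) (matrix_algebra t')"
      and add: "\<And>x y. x \<in> matrix_algebra t \<Longrightarrow> y \<in> matrix_algebra t \<Longrightarrow> \<phi> (x + y) = \<phi> x + \<phi> y"
      and scale: "\<And>c x. x \<in> matrix_algebra t \<Longrightarrow> \<phi> (mat_scale c x) = mat_scale c (\<phi> x)"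
      and mult: "\<And>x y. x \<in> matrix_algebra t \<Longrightarrow> y \<in> matrix_algebra t \<Longrightarrow> \<phi> (x \<odot> y) = \<phi> x \<odot> \<phi> y"
      and degree: "\<And>g. \<phi> ` \<Gamma> g = \<Gamma>' g"
      using \<open>?M\<close> by (rule graded_isomorphicE) (rule that)
    obtain g h \<sigma> where h: "\<forall>i\<in>?N. h i \<in> grading_support \<Gamma>" and \<sigma>: "\<sigma> permutes ?N"
      and blocks: "\<forall>k\<in>{1..length p}. \<sigma> ` block p k = block p k"
      and shift: "\<forall>i\<in>?N. \<gamma>' i = \<gamma> (\<sigma> i) + h (\<sigma> i) + g"
      using \<open>?E\<close> by blast
    \<comment> \<open>Reindexed by target positions. The default 0 lies in the support, since
      \<open>\<Gamma> 0\<close> contains the identity, so units exist for every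
      \<open>k\<close>.\<close>
    define h' where "h' k = (if k \<in> ?N then h (\<sigma> k) else 0)" for k
    have "\<exists>u v. u \<in> \<Gamma>' (h' k) \<and> v \<in> \<Gamma>' (- h' k) \<and> u \<odot> v = one_mat t' \<and> v \<odot> u = one_mat t'" for k
    proof -
      have "\<Gamma> (h' k) \<noteq> {0}"
      proof (cases "k \<in> ?N")
        case True
        then have "\<sigma> k \<in> ?N" using permutes_in_image[OF \<sigma>] by blast
        with h True show ?thesis unfolding h'_def grading_support_def by auto
      next
        case False
        then show ?thesis unfolding h'_def using A.one_mat_component A.one_mat_neq_0 by auto
      qed
      then obtain x where x: "x \<in> \<Gamma> (h' k)" "x \<noteq> 0" using A.component_zero by blast
      \<comment> \<open>The support condition concerns \<open>\<Gamma>\<close>, but the units are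
        needed in \<open>\<Gamma>'\<close>: a nonzero element is carried over by the injective
        \<open>\<phi>\<close> and inverted there.\<close>
      have "\<phi> x \<noteq> \<phi> 0"
        using bij_betw_imp_inj_on[OF bij] x A.component_matrix_algebra by (metis inj_onD zero_matrix_algebra)
      moreover have "\<phi> 0 = 0" using scale[of 0 0] by simp
      moreover have "\<phi> x \<in> \<Gamma>' (h' k)" using degree x by blast
      ultimately show ?thesis using B.homogeneous_inverse by metis
    qed
    then obtain u v where uv: "\<And>k. u k \<in> \<Gamma>' (h' k)" "\<And>k. v k \<in> \<Gamma>' (- h' k)"
      "\<And>k. u k \<odot> v k = one_mat t'" "\<And>k. v k \<odot> u k = one_mat t'"
      by metis
    \<comment> \<open>The target once more, with \<open>p\<close> in place of \<open>p'\<close>,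
      since \<open>regrading\<close> has one block structure for both sides.\<close>
    interpret B': block_grading t' \<Gamma>' p \<gamma>' by unfold_locales
    interpret R: regrading t t' \<Gamma> \<Gamma>' p \<gamma> \<gamma>' \<phi> g h' \<sigma> u v
      by unfold_locales (fact bij add scale mult degree uv \<sigma> blocks | simp add: shift h'_def)+
    show ?lhs unfolding lhs using R.graded_isomorphic_alg by (simp only: pp)
  qed
qed

end
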